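(* Let $d\geq 2$, $1\leq k\leq d-1$, let $A\subset\mathbb{R}^d$ have positive reach and let $a\in T_k(A)$. Then there exist $\delta>0$ and a $k$-dimensional $C^{1,1}$ surface $\Gamma\subset\mathbb{R}^d$ such that $T_k(A)\cap B(a,\delta)\subset\Gamma$.
   Context: A set $A\subset\mathbb{R}^d$ has positive reach if there is $\varepsilon>0$ such that every $x$ with $\mathrm{dist}(x,A)<\varepsilon$ has a unique nearest point in $A$. $\operatorname{Tan}(A,x)$ is the tangent cone ($u\in\operatorname{Tan}(A,x)$ iff $u=0$ or $r_i(x_i-x)\to u$ for some $x\neq x_i\in A$, $x_i\to x$, $r_i>0$), and $T_k(A)$ is the set of $x\in A$ with $\dim\operatorname{span}\operatorname{Tan}(A,x)=k$. A $k$-dimensional $C^{1,1}$ surface ($0<k<d$) is a set $\{w+\varphi(w):w\in W\}$ where $W$ is a $k$-dimensional linear subspace of $\mathbb{R}^d$ and $\varphi:W\to W^\perp$ is a $C^{1,1}$ mapping (differentiable with Lipschitz derivative). *)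

theory Defs
  imports "HOL-Analysis.Analysis"
begin

definition positive_reach :: "'a::euclidean_space set \<Rightarrow> bool" where
  "positive_reach A \<longleftrightarrow>
     (\<exists>\<epsilon>>0. \<forall>x. infdist x A < \<epsilon> \<longrightarrow>
        (\<exists>!y. y \<in> A \<and> (\<forall>z\<in>A. dist x y \<le> dist x z)))"

definition Tan :: "'a::euclidean_space set \<Rightarrow> 'a \<Rightarrow> 'a set" where
  "Tan A x = {u. u = 0 \<or>
     (\<exists>xs :: nat \<Rightarrow> 'a. \<exists>r :: nat \<Rightarrow> real.
        (\<forall>i. xs i \<in> A \<and> xs i \<noteq> x \<and> r i > 0) \<and> xs \<longlonglongrightarrow> x \<and>
        (\<lambda>i. r i *\<^sub>R (xs i - x)) \<longlonglongrightarrow> u)}"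

definition T_k :: "'a::euclidean_space set \<Rightarrow> nat \<Rightarrow> 'a set" where
  "T_k A k = {x \<in> A. dim (span (Tan A x)) = k}"

definition C11_surface :: "nat \<Rightarrow> 'a::euclidean_space set \<Rightarrow> bool" where
  "C11_surface k \<Gamma> \<longleftrightarrow>
     (\<exists>W :: 'a set. \<exists>\<phi> :: 'a \<Rightarrow> 'a. \<exists>D :: 'a \<Rightarrow> 'a \<Rightarrow> 'a.
        subspace W \<and> dim W = k \<and>
        (\<forall>w\<in>W. \<forall>v\<in>W. inner v (\<phi> w) = 0) \<and>
        (\<forall>w\<in>W. (\<phi> has_derivative D w) (at w within W)) \<and>
        (\<exists>L. \<forall>w1\<in>W. \<forall>w2\<in>W. \<forall>h\<in>W.
            norm (D w1 h - D w2 h) \<le> L * norm (w1 - w2) * norm h) \<and>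
        \<Gamma> = {w + \<phi> w | w. w \<in> W})"

end

theory Submission
  imports Defs
begin

text \<open>Uniqueness of nearest points near \<open>A\<close> forces every outward normal segment to extend to a
  fixed length \<open>R\<close>. Hence a convex combination \<open>(1 - l) x + l y\<close> of points of \<open>A\<close> has distance at
  most \<open>l \<bar>y - x\<bar>\<^sup>2 / R\<close> from \<open>A\<close>. Letting \<open>l\<close> tend to \<open>0\<close>, \<open>y - x\<close> is within \<open>\<bar>y - x\<bar>\<^sup>2 / R\<close> of the
  tangent cone at \<open>x\<close>; and every tangent direction at \<open>a\<close> is approximately realised by points of \<open>A\<close>
  from every \<open>x \<in> A\<close> near \<open>a\<close>, at every small scale. So for \<open>x \<in> T\<^sub>k(A)\<close> near \<open>a\<close> the space spanned by
  the tangent cone is the graph of a linear map over \<open>W = span Tan(A, a)\<close>, and comparing two such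
  spaces in points of \<open>A\<close> at scale \<open>\<bar>x - x'\<bar>\<close> shows that this map depends on \<open>x\<close> in a Lipschitz way.
  Thus \<open>T\<^sub>k(A)\<close> near \<open>a\<close> carries a \<open>C\<^sup>1\<^sup>,\<^sup>1\<close> Whitney jet over a subset of \<open>W\<close>, which is extended by a
  convex envelope.\<close>

subsection \<open>Nearest points and tangent cones\<close>

definition nearest_point :: "'a::metric_space set \<Rightarrow> 'a \<Rightarrow> 'a \<Rightarrow> bool" where
  "nearest_point A x p \<longleftrightarrow> p \<in> A \<and> (\<forall>z\<in>A. dist x p \<le> dist x z)"

lemma nearest_point_iff_infdist:
  "nearest_point A x p \<longleftrightarrow> p \<in> A \<and> dist x p = infdist x A"
proof
  assume n: "nearest_point A x p"
  then have "dist x p \<le> infdist x A"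
    unfolding infdist_def nearest_point_def by (auto intro!: cINF_greatest)
  with n show "p \<in> A \<and> dist x p = infdist x A"
    by (auto simp: nearest_point_def intro: antisym infdist_le)
next
  assume "p \<in> A \<and> dist x p = infdist x A"
  then show "nearest_point A x p"
    by (auto simp: nearest_point_def infdist_le)
qed

text \<open>The open ball around \<open>q\<close> through \<open>p\<close> lies inside the open ball
  around \<open>w\<close> through \<open>p\<close>, and the latter misses \<open>A\<close>.\<close>

lemma nearest_point_segment:
  fixes w q p :: "'a::real_normed_vector"
  assumes "nearest_point A w p" and "dist w p = dist w q + dist q p"
  shows "nearest_point A q p"
  unfolding nearest_point_def
proof (intro conjI ballI)
  show "p \<in> A" using assms by (simp add: nearest_point_def)
next
  fix z assume "z \<in> A"
  then have "dist w p \<le> dist w z" using assms by (simp add: nearest_point_def)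
  also have "\<dots> \<le> dist w q + dist q z" by (rule dist_triangle)
  finally show "dist q p \<le> dist q z" using assms(2) by simp
qed

text \<open>Positive reach with its radius kept as a parameter, since the later estimates depend on
  it quantitatively.\<close>

definition unique_nearest :: "'a::euclidean_space set \<Rightarrow> real \<Rightarrow> bool" where
  "unique_nearest A \<epsilon> \<longleftrightarrow> (\<forall>x. infdist x A < \<epsilon> \<longrightarrow> (\<exists>!p. nearest_point A x p))"

lemma unique_nearest_closed:
  assumes "unique_nearest A \<epsilon>" and "\<epsilon> > 0"
  shows "closed A" and "A \<noteq> {}"
proof -
  have *: "\<exists>p. nearest_point A x p" if "infdist x A < \<epsilon>" for x
    using assms(1) that unfolding unique_nearest_def by blast
  \<comment> \<open>\<open>infdist\<close> to the empty set is \<open>0\<close> by convention, so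
    the hypothesis would demand a nearest point in the empty set.\<close>
  show ne: "A \<noteq> {}"
    using *[of 0] assms(2) by (auto simp: nearest_point_def infdist_def split: if_splits)
  have "x \<in> A" if "x \<in> closure A" for x
  proof -
    have "infdist x A = 0" using that ne in_closure_iff_infdist_zero by blast
    with * assms(2) obtain p where "nearest_point A x p" by fastforce
    with \<open>infdist x A = 0\<close> show ?thesis by (auto simp: nearest_point_iff_infdist)
  qed
  then show "closed A" using closure_subset_eq by blast
qed

text \<open>Closed graph argument: \<open>dist\<close> and \<open>infdist\<close> are continuous,
  the values of \<open>P\<close> stay in a compact part \<open>T\<close> of \<open>A\<close>, and
  uniqueness forces every pair satisfying the distance equation to lie on the graph.\<close>

lemma nearest_point_continuous:
  assumes un: "unique_nearest A \<epsilon>" and "\<epsilon> > 0"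
    and K: "compact K" "\<And>x. x \<in> K \<Longrightarrow> infdist x A < \<epsilon>"
    and P: "\<And>x. x \<in> K \<Longrightarrow> nearest_point A x (P x)"
  shows "continuous_on K P"
proof -
  obtain q r where qr: "K \<subseteq> cball q r"
    using compact_imp_bounded[OF K(1)] bounded_subset_cball by blast
  define T where "T = A \<inter> cball q (r + \<epsilon>)"
  have "compact T"
    unfolding T_def using unique_nearest_closed[OF un \<open>\<epsilon> > 0\<close>] by (simp add: closed_Int_compact)
  moreover have PT: "P x \<in> T" if "x \<in> K" for x
  proof -
    have "dist x (P x) < \<epsilon>" "P x \<in> A"
      using K(2) P that by (auto simp: nearest_point_iff_infdist)
    moreover have "dist q x \<le> r" using qr that by auto
    moreover have "dist q (P x) \<le> dist q x + dist x (P x)" by (rule dist_triangle)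
    ultimately show ?thesis by (auto simp: T_def)
  qed
  moreover have "(\<lambda>x. (x, P x)) ` K = (K \<times> T) \<inter> {z. dist (fst z) (snd z) = infdist (fst z) A}"
    (is "?l = ?r")
  proof
    show "?l \<subseteq> ?r" using PT P by (auto simp: nearest_point_iff_infdist)
    show "?r \<subseteq> ?l"
    proof clarify
      fix x p assume "x \<in> K" "p \<in> T" "dist (fst (x, p)) (snd (x, p)) = infdist (fst (x, p)) A"
      then have "nearest_point A x p" "nearest_point A x (P x)" "infdist x A < \<epsilon>"
        using P K(2) by (auto simp: nearest_point_iff_infdist T_def)
      then have "p = P x" using un by (auto simp: unique_nearest_def)
      with \<open>x \<in> K\<close> show "(x, p) \<in> ?l" by auto
    qed
  qed
  moreover have "closed {z. dist (fst z) (snd z) = infdist (fst z) A}"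
    by (intro closed_Collect_eq continuous_intros)
  moreover have "closed (K \<times> T)"
    using K(1) \<open>compact T\<close> by (intro closed_Times compact_imp_closed)
  ultimately show ?thesis
    by (intro continuous_from_closed_graph[of T]) (auto intro: closed_Int)
qed

text \<open>Brouwer's theorem for \<open>w \<mapsto> q + s (q - P w) / \<bar>q - P w\<bar>\<close> on the ball of radius \<open>s\<close>
  around \<open>q\<close> yields a \<open>w\<close> whose nearest point sees \<open>q\<close> on the way to \<open>w\<close>; this nearest point
  is then also the one of \<open>q\<close>, so \<open>w\<close> lies on the normal ray through \<open>q\<close>.\<close>

lemma nearest_point_extend:
  assumes un: "unique_nearest A \<epsilon>" and p: "nearest_point A q p" and "q \<noteq> p"
    and s: "0 < s" "dist q p + s < \<epsilon>"
  shows "nearest_point A (q + (s / norm (q - p)) *\<^sub>R (q - p)) p"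
proof -
  have \<epsilon>: "\<epsilon> > 0" using s by (smt (verit) zero_le_dist)
  have q: "infdist q A = dist q p" "p \<in> A" using p by (auto simp: nearest_point_iff_infdist)
  have near: "infdist w A < \<epsilon>" if "w \<in> cball q s" for w
    using infdist_triangle[of w A q] q that s by (auto simp: dist_commute)
  define P where "P w = (SOME p. nearest_point A w p)" for w
  have P: "nearest_point A w (P w)" if "w \<in> cball q s" for w
    unfolding P_def using un near[OF that] by (meson someI_ex unique_nearest_def)
  have cP: "continuous_on (cball q s) P"
    using un \<epsilon> near P by (intro nearest_point_continuous[of A \<epsilon>]) auto
  have ne: "q \<noteq> P w" if "w \<in> cball q s" for w
  proof
    assume "q = P w"
    then have "infdist q A = 0" using P[OF that] by (simp add: nearest_point_def)
    then show False using q \<open>q \<noteq> p\<close> by simp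
  qed
  define T where "T w = q + (s / norm (q - P w)) *\<^sub>R (q - P w)" for w
  have "continuous_on (cball q s) T"
    unfolding T_def using ne by (intro continuous_intros cP) auto
  moreover have "T \<in> cball q s \<rightarrow> cball q s"
    using ne s by (auto simp: T_def dist_norm)
  ultimately obtain w where w: "w \<in> cball q s" "T w = w"
    using s by (elim brouwer[of "cball q s" T, rotated -1]) auto
  have weq: "w = q + (s / norm (q - P w)) *\<^sub>R (q - P w)" using w(2) by (simp add: T_def)
  have n0: "norm (q - P w) > 0" using ne[OF w(1)] by simp
  have "w - P w = (1 + s / norm (q - P w)) *\<^sub>R (q - P w)"
    by (subst weq) (simp add: algebra_simps)
  then have "dist w (P w) = (1 + s / norm (q - P w)) * norm (q - P w)"
    using s n0 by (simp add: dist_norm add_pos_pos)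
  also have "\<dots> = s + dist q (P w)"
    using n0 by (simp add: dist_norm field_simps)
  also have "s = norm ((s / norm (q - P w)) *\<^sub>R (q - P w))" using n0 s by simp
  also have "\<dots> = dist w q" using weq by (metis add_diff_cancel_left' dist_norm)
  finally have "nearest_point A q (P w)"
    using P[OF w(1)] by (intro nearest_point_segment[of A w "P w" q]) auto
  then have "P w = p"
    using un p near[of q] s by (auto simp: unique_nearest_def)
  then show ?thesis using P[OF w(1)] weq by simp
qed

text \<open>Moving the centre out along the normal at \<open>p\<close> to distance \<open>R\<close>
  gives an open ball that still misses \<open>A\<close>. Squaring
  \<open>dist w p \<le> dist w y\<close> for the new centre \<open>w\<close> yields the bound; the
  factor \<open>norm (z - p)\<close> is cleared so that \<open>z = p\<close> is covered.\<close>

lemma nearest_point_normal: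
  assumes un: "unique_nearest A \<epsilon>" and p: "nearest_point A z p"
    and R: "dist z p < R" "R < \<epsilon>" and y: "y \<in> A"
  shows "2 * R * ((y - p) \<bullet> (z - p)) \<le> (norm (y - p))\<^sup>2 * norm (z - p)"
proof (cases "z = p")
  case False
  define n where "n = norm (z - p)"
  define w where "w = z + ((R - n) / n) *\<^sub>R (z - p)"
  have n: "n > 0" "n < R" using False R by (auto simp: n_def dist_norm)
  have "nearest_point A w p"
    unfolding w_def n_def
    using nearest_point_extend[OF un p False, of "R - n"] R n by (simp add: dist_norm n_def)
  then have "dist w p \<le> dist w y" using y by (simp add: nearest_point_def)
  moreover have wp: "w - p = (R / n) *\<^sub>R (z - p)"
  proof -
    have "w - p = (1 + (R - n) / n) *\<^sub>R (z - p)" by (simp add: w_def algebra_simps)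
    also have "1 + (R - n) / n = R / n" using n by (simp add: field_simps)
    finally show ?thesis .
  qed
  moreover have "w - y = (R / n) *\<^sub>R (z - p) - (y - p)" using wp by (simp add: algebra_simps)
  ultimately have "norm ((R / n) *\<^sub>R (z - p)) \<le> norm ((R / n) *\<^sub>R (z - p) - (y - p))"
    by (simp add: dist_norm)
  then have "(norm ((R / n) *\<^sub>R (z - p)))\<^sup>2 \<le> (norm ((R / n) *\<^sub>R (z - p) - (y - p)))\<^sup>2"
    by simp
  then have "2 * (R / n) * ((y - p) \<bullet> (z - p)) \<le> (norm (y - p))\<^sup>2"
    unfolding power2_norm_eq_inner inner_diff_left[of "(R / n) *\<^sub>R (z - p)"]
      inner_diff_right[of _ "(R / n) *\<^sub>R (z - p)"] inner_commute[of "z - p" "y - p"]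
      inner_scaleR_left inner_scaleR_right
    by (simp add: right_diff_distrib diff_divide_distrib)
  then show ?thesis using n by (simp add: n_def[symmetric] field_simps)
qed simp

text \<open>Here \<open>p\<close> is the nearest point of the convex combination \<open>z\<close>.
  The normal inequalities at \<open>p\<close> for \<open>x\<close> and for \<open>y\<close>,
  averaged with weights \<open>1 - l\<close> and \<open>l\<close>, control
  \<open>norm (z - p)\<close>.\<close>

lemma nearest_point_convex_combination:
  assumes un: "unique_nearest A \<epsilon>" and R: "0 < R" "R < \<epsilon>"
    and xy: "x \<in> A" "y \<in> A" "dist x y < R" and l: "0 \<le> l" "l \<le> 1"
  obtains p where "p \<in> A" "norm (p - x - l *\<^sub>R (y - x)) \<le> l * (norm (y - x))\<^sup>2 / R"
proof -
  define z where "z = x + l *\<^sub>R (y - x)"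
  have "dist z x = l * dist x y" using l by (simp add: z_def dist_norm norm_minus_commute)
  also have "\<dots> \<le> dist x y" using l by (simp add: mult_left_le_one_le)
  finally have zx: "dist z x < R" using xy by simp
  then have "infdist z A < R" using infdist_le[of x A z] xy by simp
  then obtain p where p: "nearest_point A z p" using un R by (force simp: unique_nearest_def)
  then have zpR: "dist z p < R" using zx xy by (force simp: nearest_point_def)
  define n where "n = z - p"
  have 1: "2 * R * ((x - p) \<bullet> n) \<le> (norm (x - p))\<^sup>2 * norm n"
    unfolding n_def using nearest_point_normal[OF un p zpR R(2)] xy by simp
  have 2: "2 * R * ((y - p) \<bullet> n) \<le> (norm (y - p))\<^sup>2 * norm n"
    unfolding n_def using nearest_point_normal[OF un p zpR R(2)] xy by simp
  have neq: "n = (1 - l) *\<^sub>R (x - p) + l *\<^sub>R (y - p)"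
    by (simp add: n_def z_def algebra_simps)
  have "n \<bullet> n = (1 - l) * ((x - p) \<bullet> n) + l * ((y - p) \<bullet> n)"
    by (subst (1) neq) (simp add: inner_add_left)
  then have "2 * R * (n \<bullet> n) = (1 - l) * (2 * R * ((x - p) \<bullet> n)) + l * (2 * R * ((y - p) \<bullet> n))"
    by (simp only: distrib_left mult.left_commute)
  also have "\<dots> \<le> (1 - l) * ((norm (x - p))\<^sup>2 * norm n) + l * ((norm (y - p))\<^sup>2 * norm n)"
    using 1 2 l by (intro add_mono mult_left_mono) auto
  also have "\<dots> = ((1 - l) * (norm (x - p))\<^sup>2 + l * (norm (y - p))\<^sup>2) * norm n"
    by (simp add: algebra_simps)
  \<comment> \<open>Variance identity: the weighted mean of the squared norms is the squared norm of
    the mean \<open>n\<close> plus a term in \<open>y - x\<close>.\<close>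
  also have "(1 - l) * (norm (x - p))\<^sup>2 + l * (norm (y - p))\<^sup>2
      = (norm n)\<^sup>2 + l * (1 - l) * (norm (y - x))\<^sup>2"
    unfolding neq dot_square_norm[symmetric]
    by (simp add: inner_diff inner_add inner_commute algebra_simps)
  finally have main: "2 * R * (norm n)\<^sup>2 \<le> ((norm n)\<^sup>2 + l * (1 - l) * (norm (y - x))\<^sup>2) * norm n"
    by (simp add: dot_square_norm)
  have "R * norm n \<le> l * (norm (y - x))\<^sup>2"
  proof (cases "n = 0")
    case False
    then have "0 < norm n" by simp
    moreover have "(2 * R * norm n) * norm n \<le> ((norm n)\<^sup>2 + l * (1 - l) * (norm (y - x))\<^sup>2) * norm n"
      using main by (simp only: power2_eq_square[of "norm n"] mult.assoc)
    ultimately have "2 * R * norm n \<le> (norm n)\<^sup>2 + l * (1 - l) * (norm (y - x))\<^sup>2"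
      by (metis mult_right_le_imp_le)
    \<comment> \<open>Since \<open>norm n < R\<close>, the quadratic term is absorbed by half of the
      left-hand side.\<close>
    moreover have "(norm n)\<^sup>2 \<le> R * norm n"
      using zpR by (simp add: n_def dist_norm power2_eq_square mult_right_mono)
    moreover have "l * (1 - l) * (norm (y - x))\<^sup>2 \<le> l * (norm (y - x))\<^sup>2"
      using l by (intro mult_right_mono) (auto simp: algebra_simps)
    ultimately show ?thesis by linarith
  qed (use l in auto)
  then have "norm n \<le> l * (norm (y - x))\<^sup>2 / R" using R by (simp add: field_simps)
  moreover have "norm n = norm (p - x - l *\<^sub>R (y - x))"
    unfolding n_def z_def by (metis diff_diff_eq norm_minus_commute)
  ultimately show ?thesis using that p by (auto simp: nearest_point_def)
qed

section \<open>Tangent cones near a point of the set\<close>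

lemma Tan_scale:
  assumes "u \<in> Tan A x" "c > 0"
  shows "c *\<^sub>R u \<in> Tan A x"
proof (cases "u = 0")
  case False
  then obtain xs r where xr: "\<forall>i. xs i \<in> A \<and> xs i \<noteq> x \<and> r i > 0" "xs \<longlonglongrightarrow> x"
    "(\<lambda>i. r i *\<^sub>R (xs i - x)) \<longlonglongrightarrow> u"
    using assms unfolding Tan_def by auto
  have "(\<lambda>i. c *\<^sub>R (r i *\<^sub>R (xs i - x))) \<longlonglongrightarrow> c *\<^sub>R u"
    by (intro tendsto_intros xr)
  then show ?thesis
    using xr assms unfolding Tan_def
    by (auto intro!: exI[of _ xs] exI[of _ "\<lambda>i. c * r i"])
qed (simp add: Tan_def)

text \<open>Points of \<open>A\<close> near \<open>x + l (y - x)\<close> give difference quotients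
  \<open>v\<close> in a fixed ball around \<open>y - x\<close>; by compactness some of them converge
  as \<open>l\<close> tends to \<open>0\<close>, and the limit is tangent.\<close>

lemma Tan_near_difference:
  assumes un: "unique_nearest A \<epsilon>" and R: "0 < R" "R < \<epsilon>"
    and xy: "x \<in> A" "y \<in> A" "dist x y < R"
  obtains v where "v \<in> Tan A x" "norm (v - (y - x)) \<le> (norm (y - x))\<^sup>2 / R"
proof (cases "y = x")
  case False
  define l where "l n = inverse (real (Suc n))" for n
  have l: "l n > 0" "l n \<le> 1" for n by (auto simp: l_def field_simps)
  have l0: "l \<longlonglongrightarrow> 0" unfolding l_def by (rule LIMSEQ_inverse_real_of_nat)
  have "\<exists>p. p \<in> A \<and> norm (p - x - l n *\<^sub>R (y - x)) \<le> l n * (norm (y - x))\<^sup>2 / R" for n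
    using nearest_point_convex_combination[OF un R xy, of "l n"] l[of n] by (metis less_imp_le)
  then obtain p where p: "\<And>n. p n \<in> A"
    "\<And>n. norm (p n - x - l n *\<^sub>R (y - x)) \<le> l n * (norm (y - x))\<^sup>2 / R" by metis
  define v where "v n = inverse (l n) *\<^sub>R (p n - x)" for n
  have pv: "p n = x + l n *\<^sub>R v n" for n using l[of n] by (simp add: v_def)
  have near: "norm (v n - (y - x)) \<le> (norm (y - x))\<^sup>2 / R" for n
  proof -
    have "p n - x - l n *\<^sub>R (y - x) = l n *\<^sub>R (v n - (y - x))"
      by (simp add: pv algebra_simps)
    then have "l n * norm (v n - (y - x)) \<le> l n * ((norm (y - x))\<^sup>2 / R)"
      using p(2)[of n] l[of n] by simp
    then show ?thesis using l(1)[of n] by (rule mult_left_le_imp_le)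
  qed
  then have "v n \<in> cball (y - x) ((norm (y - x))\<^sup>2 / R)" for n
    by (simp add: dist_norm norm_minus_commute)
  then obtain u s where us: "u \<in> cball (y - x) ((norm (y - x))\<^sup>2 / R)" "strict_mono s"
    "(v \<circ> s) \<longlonglongrightarrow> u"
    using compact_cball[unfolded compact_def] by metis
  have "(norm (y - x))\<^sup>2 < R * norm (y - x)"
    using False xy by (simp add: power2_eq_square dist_norm norm_minus_commute)
  \<comment> \<open>The closed ball containing all \<open>v n\<close> therefore misses
    \<open>0\<close>, so that \<open>p n \<noteq> x\<close>, as \<open>Tan\<close> demands.\<close>
  then have "(norm (y - x))\<^sup>2 / R < norm (y - x)" using R by (simp add: field_simps)
  then have "v n \<noteq> 0" for n using near[of n] norm_minus_commute[of 0 "y - x"] by auto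
  then have "p n \<noteq> x" for n using l[of n] by (simp add: pv)
  moreover from us have "(\<lambda>n. x + l (s n) *\<^sub>R v (s n)) \<longlonglongrightarrow> x + 0 *\<^sub>R u"
    using LIMSEQ_subseq_LIMSEQ[OF l0 us(2)] us(3)
    by (intro tendsto_intros) (auto simp: o_def)
  then have "(\<lambda>n. p (s n)) \<longlonglongrightarrow> x" by (simp add: pv)
  moreover have "(\<lambda>n. inverse (l (s n)) *\<^sub>R (p (s n) - x)) \<longlonglongrightarrow> u"
    using us(3) by (simp add: o_def v_def)
  moreover have "inverse (l (s n)) > 0" for n using l(1) by simp
  ultimately have "u \<in> Tan A x"
    unfolding Tan_def mem_Collect_eq using p(1)
    by (intro disjI2 exI[of _ "\<lambda>n. p (s n)"] exI[of _ "\<lambda>n. inverse (l (s n))"]) blast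
  then show ?thesis using that us(1) by (simp add: dist_norm norm_minus_commute)
qed (use that[of 0] in \<open>auto simp: Tan_def\<close>)

text \<open>One point \<open>y\<close> of \<open>A\<close> whose scaled difference from
  \<open>a\<close> is close to \<open>u\<close> serves for all \<open>x\<close> near
  \<open>a\<close> by continuity. Convex combinations of \<open>x\<close> and this \<open>y\<close>
  then realise \<open>t u\<close> at every small scale \<open>t\<close>.\<close>

lemma Tan_uniform:
  assumes un: "unique_nearest A \<epsilon>" and R: "0 < R" "R < \<epsilon>"
    and u: "u \<in> Tan A a" and \<eta>: "\<eta> > 0"
  obtains \<delta> where "\<delta> > 0"
    "\<And>x t. x \<in> A \<Longrightarrow> dist x a < \<delta> \<Longrightarrow> 0 < t \<Longrightarrow> t \<le> \<delta> \<Longrightarrow> \<exists>p\<in>A. norm (p - x - t *\<^sub>R u) \<le> \<eta> * t"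
proof (cases "u = 0")
  case True
  then show ?thesis using that[of 1] \<eta> by force
next
  case False
  then obtain xs r where xr: "\<And>i. xs i \<in> A" "\<And>i. r i > 0" "xs \<longlonglongrightarrow> a"
    "(\<lambda>i. r i *\<^sub>R (xs i - a)) \<longlonglongrightarrow> u"
    using u unfolding Tan_def by auto
  have "(\<lambda>i. norm (r i *\<^sub>R (xs i - a) - u) + norm (r i *\<^sub>R (xs i - a)) * norm (xs i - a) / R)
      \<longlonglongrightarrow> norm (u - u) + norm u * norm (a - a) / R"
    using R by (intro tendsto_intros xr) auto
  then have "\<forall>\<^sub>F i in sequentially. norm (r i *\<^sub>R (xs i - a) - u)
      + norm (r i *\<^sub>R (xs i - a)) * norm (xs i - a) / R < \<eta>"
    using \<eta> by (intro order_tendstoD(2)) auto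
  moreover have "\<forall>\<^sub>F i in sequentially. dist (xs i) a < R"
    using xr(3) R(1) by (rule tendstoD)
  ultimately obtain i where i: "norm (r i *\<^sub>R (xs i - a) - u)
      + norm (r i *\<^sub>R (xs i - a)) * norm (xs i - a) / R < \<eta>" "dist (xs i) a < R"
    by (metis (mono_tags, lifting) eventually_conj eventually_happens sequentially_bot)
  define y where "y = xs i"
  define \<rho> where "\<rho> = r i"
  \<comment> \<open>Total error per unit of \<open>t\<close>: the deviation of the scaled difference
    from \<open>u\<close>, plus the convex combination bound for the weight
    \<open>l = t * \<rho>\<close> divided by \<open>t\<close>.\<close>
  define E where "E x = norm (\<rho> *\<^sub>R (y - x) - u) + norm (\<rho> *\<^sub>R (y - x)) * norm (y - x) / R" for x
  have y: "y \<in> A" "\<rho> > 0" using xr by (auto simp: y_def \<rho>_def)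
  have "(E \<longlongrightarrow> E a) (nhds a)" unfolding E_def using R by (intro tendsto_intros filterlim_ident) auto
  then have "\<forall>\<^sub>F x in nhds a. E x < \<eta>"
    using i(1) unfolding E_def y_def \<rho>_def by (intro order_tendstoD(2))
  moreover have "((\<lambda>x. dist y x) \<longlongrightarrow> dist y a) (nhds a)" by (intro tendsto_intros filterlim_ident)
  then have "\<forall>\<^sub>F x in nhds a. dist y x < R"
    using i(2) unfolding y_def by (intro order_tendstoD(2))
  ultimately have "\<forall>\<^sub>F x in nhds a. E x < \<eta> \<and> dist y x < R" by (rule eventually_conj)
  then obtain d where d: "d > 0" "\<And>x. dist x a < d \<Longrightarrow> E x < \<eta> \<and> dist y x < R"
    unfolding eventually_nhds_metric by blast
  show ?thesis
  proof (rule that[of "min d (1 / \<rho>)"])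
    show "min d (1 / \<rho>) > 0" using d y by simp
  next
    fix x t assume x: "x \<in> A" "dist x a < min d (1 / \<rho>)" and t: "0 < t" "t \<le> min d (1 / \<rho>)"
    have l: "0 \<le> t * \<rho>" "t * \<rho> \<le> 1" using t y by (auto simp: field_simps)
    have Ex: "E x < \<eta>" "dist x y < R" using d(2)[of x] x by (auto simp: dist_commute)
    obtain p where p: "p \<in> A" "norm (p - x - (t * \<rho>) *\<^sub>R (y - x)) \<le> t * \<rho> * (norm (y - x))\<^sup>2 / R"
      using nearest_point_convex_combination[OF un R x(1) y(1) Ex(2) l] by blast
    have "p - x - t *\<^sub>R u = (p - x - (t * \<rho>) *\<^sub>R (y - x)) + t *\<^sub>R (\<rho> *\<^sub>R (y - x) - u)"
      by (simp add: scaleR_diff_right)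
    also have "norm \<dots> \<le> t * \<rho> * (norm (y - x))\<^sup>2 / R + t * norm (\<rho> *\<^sub>R (y - x) - u)"
      using p(2) t(1) by (intro norm_triangle_le add_mono) auto
    also have "\<dots> = t * E x" using y by (simp add: E_def power2_eq_square distrib_left mult.assoc)
    also have "\<dots> \<le> \<eta> * t" using Ex t by (simp add: mult.commute)
    finally show "\<exists>p\<in>A. norm (p - x - t *\<^sub>R u) \<le> \<eta> * t" using p by blast
  qed
qed

lemma Tan_uniform_finite:
  assumes un: "unique_nearest A \<epsilon>" and R: "0 < R" "R < \<epsilon>"
    and B: "finite B" "B \<subseteq> Tan A a" and \<eta>: "\<eta> > 0"
  obtains \<delta> where "\<delta> > 0"
    "\<And>u x t. u \<in> B \<Longrightarrow> x \<in> A \<Longrightarrow> dist x a < \<delta> \<Longrightarrow> 0 < t \<Longrightarrow> t \<le> \<delta> \<Longrightarrow>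
      \<exists>p\<in>A. norm (p - x - t *\<^sub>R u) \<le> \<eta> * t"
proof -
  have "\<exists>d>0. \<forall>x t. x \<in> A \<longrightarrow> dist x a < d \<longrightarrow> 0 < t \<longrightarrow> t \<le> d \<longrightarrow>
      (\<exists>p\<in>A. norm (p - x - t *\<^sub>R u) \<le> \<eta> * t)" if u: "u \<in> B" for u
  proof -
    obtain d where "d > 0" "\<And>x t. x \<in> A \<Longrightarrow> dist x a < d \<Longrightarrow> 0 < t \<Longrightarrow> t \<le> d \<Longrightarrow>
        \<exists>p\<in>A. norm (p - x - t *\<^sub>R u) \<le> \<eta> * t"
      using Tan_uniform[OF un R subsetD[OF B(2) u] \<eta>] by blast
    then show ?thesis by blast
  qed
  then obtain \<delta> where \<delta>: "\<And>u. u \<in> B \<Longrightarrow> \<delta> u > 0"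
    "\<And>u x t. u \<in> B \<Longrightarrow> x \<in> A \<Longrightarrow> dist x a < \<delta> u \<Longrightarrow> 0 < t \<Longrightarrow> t \<le> \<delta> u \<Longrightarrow>
      \<exists>p\<in>A. norm (p - x - t *\<^sub>R u) \<le> \<eta> * t"
    by metis
  \<comment> \<open>The entry \<open>1\<close> keeps the minimum meaningful when \<open>B\<close> is
    empty.\<close>
  define \<delta>0 where "\<delta>0 = Min (insert 1 (\<delta> ` B))"
  have le: "\<delta>0 \<le> \<delta> u" if "u \<in> B" for u
    unfolding \<delta>0_def using B that by (intro Min_le) auto
  have "\<delta>0 > 0" unfolding \<delta>0_def using B \<delta>(1) by (subst Min_gr_iff) auto
  then show ?thesis
    by (rule that) (use \<delta>(2) le in \<open>meson less_le_trans order_trans\<close>)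
qed

text \<open>A point \<open>p\<close> at distance of order \<open>t\<close> from \<open>x\<close> has
  \<open>p - x\<close> within order \<open>t\<close> squared of the tangent cone; after division by
  \<open>t\<close> this error is small.\<close>

lemma Tan_near_of_approximation:
  assumes un: "unique_nearest A \<epsilon>" and R: "0 < R" "R < \<epsilon>"
    and x: "x \<in> A" and \<eta>: "\<eta> > 0" and \<delta>: "\<delta> > 0"
    and app: "\<And>t. 0 < t \<Longrightarrow> t \<le> \<delta> \<Longrightarrow> \<exists>p\<in>A. norm (p - x - t *\<^sub>R u) \<le> \<eta> * t"
  obtains v where "v \<in> Tan A x" "norm (v - u) \<le> 2 * \<eta>"
proof -
  define m where "m = norm u + \<eta>"
  have m: "m > 0" using \<eta> by (simp add: m_def add_nonneg_pos)
  \<comment> \<open>With \<open>norm (p - x) \<le> m * t\<close>, the second bound keeps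
    \<open>p\<close> within \<open>R\<close> of \<open>x\<close>, and the third makes the quadratic
    error at most \<open>\<eta> * t\<close>.\<close>
  define t where "t = min \<delta> (min (R / (2 * m)) (\<eta> * R / m\<^sup>2))"
  have t: "t > 0" "t \<le> \<delta>" "t \<le> R / (2 * m)" "t \<le> \<eta> * R / m\<^sup>2"
    using \<delta> R m \<eta> by (auto simp: t_def)
  obtain p where p: "p \<in> A" "norm (p - x - t *\<^sub>R u) \<le> \<eta> * t" using app t by blast
  have "norm (p - x) \<le> norm (p - x - t *\<^sub>R u) + norm (t *\<^sub>R u)"
    using norm_triangle_ineq[of "p - x - t *\<^sub>R u" "t *\<^sub>R u"] by simp
  then have px: "norm (p - x) \<le> m * t" using p(2) t(1) by (simp add: m_def algebra_simps)
  have "m * t \<le> R / 2" using t(3) m by (simp add: field_simps)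
  then have "dist x p < R" using px R by (simp add: dist_norm norm_minus_commute)
  then obtain v where v: "v \<in> Tan A x" "norm (v - (p - x)) \<le> (norm (p - x))\<^sup>2 / R"
    using Tan_near_difference[OF un R x p(1)] by blast
  have "(norm (p - x))\<^sup>2 \<le> (m * t)\<^sup>2" using px by (intro power_mono) auto
  then have "(norm (p - x))\<^sup>2 / R \<le> (m * t)\<^sup>2 / R" using R by (simp add: divide_right_mono)
  also have "\<dots> = t * (m\<^sup>2 * t / R)" by (simp add: power2_eq_square)
  also have "m\<^sup>2 * t / R \<le> \<eta>" using t(4) m R by (simp add: field_simps)
  finally have "norm (v - (p - x)) \<le> \<eta> * t" using v(2) t(1) by (simp add: mult.commute)
  then have "norm (v - t *\<^sub>R u) \<le> 2 * \<eta> * t"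
    using p(2) norm_triangle_ineq[of "v - (p - x)" "p - x - t *\<^sub>R u"] by simp
  moreover have "v - t *\<^sub>R u = t *\<^sub>R (inverse t *\<^sub>R v - u)" using t by (simp add: scaleR_diff_right)
  ultimately have "norm (inverse t *\<^sub>R v - u) * t \<le> 2 * \<eta> * t"
    using t(1) by (simp add: mult.commute)
  then have "norm (inverse t *\<^sub>R v - u) \<le> 2 * \<eta>" using t(1) by simp
  moreover have "inverse t *\<^sub>R v \<in> Tan A x" using v t by (intro Tan_scale) auto
  ultimately show ?thesis using that by blast
qed

subsection \<open>Subspaces close to a given one\<close>

text \<open>Each coordinate extends to a linear functional on the whole space, which is bounded; the
  bounds are added up.\<close>

lemma independent_lower_bound:
  fixes B :: "'a::euclidean_space set"
  assumes "independent B"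
  obtains \<kappa> where "\<kappa> > 0" "\<And>c. \<kappa> * (\<Sum>b\<in>B. \<bar>c b\<bar>) \<le> norm (\<Sum>b\<in>B. c b *\<^sub>R b)"
proof -
  have fin: "finite B" using assms by (rule independent_imp_finite)
  have "\<exists>K>0. \<forall>c. \<bar>c b\<bar> \<le> K * norm (\<Sum>b\<in>B. c b *\<^sub>R b)" if b: "b \<in> B" for b
  proof -
    obtain g :: "'a \<Rightarrow> real" where g: "linear g" "\<forall>x\<in>B. g x = (if x = b then 1 else 0)"
      using linear_independent_extend[OF assms, of "\<lambda>x. if x = b then 1 else 0"] by blast
    obtain K where K: "K > 0" "\<And>x. norm (g x) \<le> K * norm x"
      using linear_bounded_pos[OF g(1)] by blast
    have "g (\<Sum>b\<in>B. c b *\<^sub>R b) = c b" for c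
    proof -
      have "g (\<Sum>b\<in>B. c b *\<^sub>R b) = (\<Sum>x\<in>B. if x = b then c x else 0)"
        using g by (auto simp: linear_sum linear_cmul intro!: sum.cong)
      also have "\<dots> = c b" using fin b by simp
      finally show ?thesis .
    qed
    then show ?thesis using K by (metis real_norm_def)
  qed
  then obtain K where K: "\<And>b. b \<in> B \<Longrightarrow> K b > 0"
    "\<And>b c. b \<in> B \<Longrightarrow> \<bar>c b\<bar> \<le> K b * norm (\<Sum>b\<in>B. c b *\<^sub>R b)" by metis
  \<comment> \<open>The summand \<open>1\<close> keeps \<open>s\<close> positive for empty
    \<open>B\<close>.\<close>
  define s where "s = (\<Sum>b\<in>B. K b) + 1"
  have "sum K B \<ge> 0" using K(1) by (intro sum_nonneg) (auto intro: less_imp_le)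
  then have s: "s > 0" by (simp add: s_def)
  show ?thesis
  proof (rule that[of "1 / s"])
    show "1 / s > 0" using s by simp
  next
    fix c
    have "(\<Sum>b\<in>B. \<bar>c b\<bar>) \<le> (\<Sum>b\<in>B. K b * norm (\<Sum>b\<in>B. c b *\<^sub>R b))"
      by (intro sum_mono K(2))
    also have "\<dots> \<le> s * norm (\<Sum>b\<in>B. c b *\<^sub>R b)"
      by (simp add: s_def distrib_right flip: sum_distrib_right)
    finally show "1 / s * (\<Sum>b\<in>B. \<bar>c b\<bar>) \<le> norm (\<Sum>b\<in>B. c b *\<^sub>R b)"
      using s by (simp add: field_simps)
  qed
qed

text \<open>Moving each basis vector by at most \<open>\<kappa> / 2\<close> costs half of the lower
  bound. The moved vectors stay independent, and counting dimensions makes them a basis of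
  \<open>V\<close> with controlled coordinates.\<close>

lemma perturbed_basis:
  fixes B V :: "'a::euclidean_space set"
  assumes ind: "independent B" and \<kappa>: "\<kappa> > 0" "\<And>c. \<kappa> * (\<Sum>b\<in>B. \<bar>c b\<bar>) \<le> norm (\<Sum>b\<in>B. c b *\<^sub>R b)"
    and V: "subspace V" "dim V = card B"
    and f: "\<And>b. b \<in> B \<Longrightarrow> f b \<in> V" "\<And>b. b \<in> B \<Longrightarrow> norm (f b - b) \<le> \<kappa> / 2" and v: "v \<in> V"
  obtains c where "v = (\<Sum>b\<in>B. c b *\<^sub>R f b)" "(\<Sum>b\<in>B. \<bar>c b\<bar>) \<le> 2 / \<kappa> * norm v"
proof -
  have fin: "finite B" using ind by (rule independent_imp_finite)
  have lower: "\<kappa> / 2 * (\<Sum>b\<in>B. \<bar>c b\<bar>) \<le> norm (\<Sum>b\<in>B. c b *\<^sub>R f b)" for c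
  proof -
    have "norm ((\<Sum>b\<in>B. c b *\<^sub>R f b) - (\<Sum>b\<in>B. c b *\<^sub>R b)) = norm (\<Sum>b\<in>B. c b *\<^sub>R (f b - b))"
      by (simp add: sum_subtractf scaleR_diff_right)
    also have "\<dots> \<le> (\<Sum>b\<in>B. \<bar>c b\<bar> * (\<kappa> / 2))"
      using f(2) by (intro sum_norm_le) (simp add: mult_left_mono del: le_divide_eq_numeral1 times_divide_eq_right)
    also have "\<dots> = \<kappa> / 2 * (\<Sum>b\<in>B. \<bar>c b\<bar>)" by (simp add: sum_distrib_left mult.commute)
    finally show ?thesis
      using \<kappa>(2)[of c] norm_triangle_ineq3[of "\<Sum>b\<in>B. c b *\<^sub>R f b" "\<Sum>b\<in>B. c b *\<^sub>R b"] by simp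
  qed
  obtain T where T: "linear T" "\<And>b. b \<in> B \<Longrightarrow> T b = f b"
    using linear_independent_extend[OF ind, of f] by blast
  have spanB: "\<exists>c. w = (\<Sum>b\<in>B. c b *\<^sub>R b) \<and> T w = (\<Sum>b\<in>B. c b *\<^sub>R f b)" if "w \<in> span B" for w
  proof -
    obtain c where c: "w = (\<Sum>b\<in>B. c b *\<^sub>R b)" using \<open>w \<in> span B\<close> span_finite[OF fin] by auto
    have "T w = (\<Sum>b\<in>B. c b *\<^sub>R f b)"
      unfolding c using T by (auto simp: linear_sum linear_cmul intro!: sum.cong)
    with c show ?thesis by blast
  qed
  have "inj_on T (span B)"
    unfolding linear_inj_on_iff_eq_0[OF T(1) subspace_span]
  proof (intro ballI impI)
    fix w assume "w \<in> span B" "T w = 0"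
    then obtain c where c: "w = (\<Sum>b\<in>B. c b *\<^sub>R b)" "(\<Sum>b\<in>B. c b *\<^sub>R f b) = 0" using spanB by metis
    have "(\<Sum>b\<in>B. \<bar>c b\<bar>) \<le> 0" using lower[of c] c(2) \<kappa>(1) by (simp add: mult_le_0_iff)
    then have "(\<Sum>b\<in>B. \<bar>c b\<bar>) = 0" by (simp add: antisym sum_nonneg)
    then have "\<forall>b\<in>B. c b = 0" using fin by (simp add: sum_nonneg_eq_0_iff)
    then show "w = 0" using c(1) by simp
  qed
  then have "dim (T ` span B) = card B"
    using dim_image_eq[OF T(1), of "span B"] dim_eq_card_independent[OF ind] by (simp add: span_span)
  moreover have "T ` span B \<subseteq> V"
  proof
    fix z assume "z \<in> T ` span B"
    then obtain c where "z = (\<Sum>b\<in>B. c b *\<^sub>R f b)" using spanB by blast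
    then show "z \<in> V" using f(1) V(1) by (auto intro!: subspace_sum subspace_scale)
  qed
  ultimately have "T ` span B = V"
    using V T(1) by (intro subspace_dim_equal linear_subspace_image) auto
  with v obtain w where "w \<in> span B" "v = T w" by blast
  then obtain c where c: "v = (\<Sum>b\<in>B. c b *\<^sub>R f b)" using spanB by blast
  have "(\<Sum>b\<in>B. \<bar>c b\<bar>) \<le> 2 / \<kappa> * norm v" using lower[of c] \<kappa>(1) c by (simp add: field_simps)
  with c show ?thesis using that by blast
qed

section \<open>Orthogonal projections and graphs over a subspace\<close>

definition orthogonal_projection :: "'a::euclidean_space set \<Rightarrow> ('a \<Rightarrow> 'a) \<Rightarrow> bool" where
  "orthogonal_projection W \<pi> \<longleftrightarrow>
     subspace W \<and> linear \<pi> \<and> (\<forall>x. \<pi> x \<in> W \<and> (\<forall>w\<in>W. w \<bullet> (x - \<pi> x) = 0))"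

lemma orthogonal_projection_exists:
  assumes "subspace W"
  obtains \<pi> where "orthogonal_projection W \<pi>"
proof -
  obtain B where B: "B \<subseteq> W" "pairwise orthogonal B" "\<And>x. x \<in> B \<Longrightarrow> norm x = 1"
    "independent B" "span B = W"
    using orthonormal_basis_subspace[OF assms] by metis
  have fin: "finite B" using B(4) by (rule independent_imp_finite)
  define \<pi> where "\<pi> x = (\<Sum>b\<in>B. (x \<bullet> b) *\<^sub>R b)" for x
  have "linear \<pi>"
    unfolding \<pi>_def
    by (intro linearI) (simp_all add: inner_add_left scaleR_add_left sum.distrib scaleR_sum_right)
  moreover have "\<pi> x \<in> W" for x
    unfolding \<pi>_def using B assms by (auto intro!: subspace_sum subspace_scale)
  moreover have "w \<bullet> (x - \<pi> x) = 0" if "w \<in> W" for w x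
  proof -
    have b0: "orthogonal (x - \<pi> x) b" if "b \<in> B" for b
    proof -
      have "\<pi> x \<bullet> b = (\<Sum>c\<in>B. if c = b then x \<bullet> b else 0)"
        unfolding \<pi>_def inner_sum_left
        using B(2,3) that by (intro sum.cong) (auto simp: pairwise_def orthogonal_def dot_square_norm)
      then show ?thesis using fin that by (simp add: orthogonal_def inner_diff_left)
    qed
    have "orthogonal (x - \<pi> x) w"
      using that B(5) b0 by (intro orthogonal_to_span[of w B]) auto
    then show ?thesis by (simp add: orthogonal_def inner_commute)
  qed
  ultimately show ?thesis using that[of \<pi>] assms by (simp add: orthogonal_projection_def)
qed

lemma orthogonal_projection_id:
  assumes "orthogonal_projection W \<pi>" "w \<in> W"
  shows "\<pi> w = w"
proof -
  have "w - \<pi> w \<in> W" using assms by (auto simp: orthogonal_projection_def intro: subspace_diff)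
  then have "(w - \<pi> w) \<bullet> (w - \<pi> w) = 0" using assms by (auto simp: orthogonal_projection_def)
  then show ?thesis by simp
qed

lemma orthogonal_projection_norm:
  assumes "orthogonal_projection W \<pi>"
  shows "norm (\<pi> x) \<le> norm x" "norm (x - \<pi> x) \<le> norm x"
proof -
  have "\<pi> x \<bullet> (x - \<pi> x) = 0" using assms by (auto simp: orthogonal_projection_def)
  then have "orthogonal (\<pi> x) (x - \<pi> x)" by (simp add: orthogonal_def)
  then have "(norm x)\<^sup>2 = (norm (\<pi> x))\<^sup>2 + (norm (x - \<pi> x))\<^sup>2"
    using norm_add_Pythagorean[of "\<pi> x" "x - \<pi> x"] by simp
  then have "(norm (\<pi> x))\<^sup>2 \<le> (norm x)\<^sup>2" "(norm (x - \<pi> x))\<^sup>2 \<le> (norm x)\<^sup>2" by simp_all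
  then show "norm (\<pi> x) \<le> norm x" "norm (x - \<pi> x) \<le> norm x" by (simp_all add: power_mono_iff)
qed

text \<open>The tilt bound makes \<open>\<pi>\<close> injective on \<open>V\<close>, hence onto
  \<open>W\<close> by dimension, and absorbing \<open>norm v / 2\<close> bounds the slope of the
  graph by \<open>1\<close>.\<close>

lemma graph_over_subspace:
  assumes \<pi>: "orthogonal_projection W \<pi>" and V: "subspace V" "dim V = dim W"
    and tilt: "\<And>v. v \<in> V \<Longrightarrow> norm (v - \<pi> v) \<le> norm v / 2"
  obtains \<Psi> where "linear \<Psi>" "\<And>v. v \<in> V \<Longrightarrow> \<Psi> v = v - \<pi> v"
    "\<And>h. norm (\<Psi> h) \<le> norm (\<pi> h)" "\<And>h. \<Psi> (\<pi> h) = \<Psi> h"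
proof -
  have lin: "linear \<pi>" and W: "subspace W" "\<And>x. \<pi> x \<in> W"
    using \<pi> by (auto simp: orthogonal_projection_def)
  have inj: "inj_on \<pi> V"
    unfolding linear_inj_on_iff_eq_0[OF lin V(1)] using tilt by fastforce
  have "\<pi> ` V = W"
  proof (rule subspace_dim_equal)
    show "subspace (\<pi> ` V)" using lin V(1) by (rule linear_subspace_image)
    have "inj_on \<pi> (span V)" using inj V(1) by (metis span_eq_iff)
    then show "dim (\<pi> ` V) \<ge> dim W" using dim_image_eq[OF lin] V(2) by simp
  qed (use W in auto)
  obtain g where g: "range g \<subseteq> V" "linear g" "\<And>v. v \<in> V \<Longrightarrow> g (\<pi> v) = v"
    using linear_exists_left_inverse_on[OF lin V(1) inj] by blast
  \<comment> \<open>Precomposing with \<open>\<pi>\<close> extends the graph map from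
    \<open>W\<close> to the whole space, so that jets can be extended there without restricting the
    domain to \<open>W\<close>.\<close>
  define \<Psi> where "\<Psi> h = g (\<pi> h) - \<pi> (g (\<pi> h))" for h
  show ?thesis
  proof
    show "linear \<Psi>"
      unfolding \<Psi>_def using lin g(2)
      by (intro linearI) (simp_all add: linear_add linear_cmul scaleR_diff_right)
    show "\<Psi> v = v - \<pi> v" if "v \<in> V" for v using g(3) that by (simp add: \<Psi>_def)
    show "\<Psi> (\<pi> h) = \<Psi> h" for h using orthogonal_projection_id[OF \<pi>] W by (simp add: \<Psi>_def)
    show "norm (\<Psi> h) \<le> norm (\<pi> h)" for h
    proof -
      obtain v where v: "v \<in> V" "\<pi> h = \<pi> v" using \<open>\<pi> ` V = W\<close> W(2)[of h] by blast
      then have "\<Psi> h = v - \<pi> v" using g(3) by (simp add: \<Psi>_def)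
      moreover have "norm v \<le> norm (v - \<pi> v) + norm (\<pi> v)"
        using norm_triangle_ineq[of "v - \<pi> v" "\<pi> v"] by simp
      ultimately show ?thesis using tilt[OF v(1)] v(2) by simp
    qed
  qed
qed

subsection \<open>Extension of \<open>C\<^sup>1\<^sup>,\<^sup>1\<close> jets\<close>

text \<open>Compare the expansions at \<open>x\<close> and \<open>y\<close> in a third point at distance \<open>norm (y - x)\<close> from \<open>y\<close>.\<close>

lemma quadratic_remainder_imp_Lipschitz_derivative:
  fixes F :: "'a::real_normed_vector \<Rightarrow> 'b::real_normed_vector"
  assumes lin: "\<And>x. linear (D x)" and C: "C \<ge> 0"
    and rem: "\<And>x y. norm (F y - F x - D x (y - x)) \<le> C * (norm (y - x))\<^sup>2"
  shows "norm (D x h - D y h) \<le> 6 * C * norm (x - y) * norm h"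
proof (cases "h = 0 \<or> x = y")
  case True
  then show ?thesis using lin by (auto simp: linear_0)
next
  case False
  define r where "r = norm (y - x)"
  define c where "c = r / norm h"
  define z where "z = y + c *\<^sub>R h"
  have r: "r > 0" and c: "c > 0" using False by (auto simp: r_def c_def)
  have zy: "norm (z - y) = r" using False r by (simp add: z_def c_def)
  have "norm (z - x) \<le> norm (z - y) + norm (y - x)"
    using norm_triangle_ineq[of "z - y" "y - x"] by simp
  then have "norm (z - x) \<le> 2 * r" using zy by (simp add: r_def)
  then have "(norm (z - x))\<^sup>2 \<le> (2 * r)\<^sup>2" by (intro power_mono) auto
  then have 1: "norm (F z - F x - D x (z - x)) \<le> C * (4 * r\<^sup>2)"
    using rem[of z x] C by (smt (verit) mult_left_mono power_mult_distrib four_x_squared)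
  have 2: "norm (F z - F y - D y (z - y)) \<le> C * r\<^sup>2" using rem[of z y] zy by simp
  have 3: "norm (F y - F x - D x (y - x)) \<le> C * r\<^sup>2" using rem[of y x] by (simp add: r_def)
  have "D x (z - x) = D x (z - y) + D x (y - x)"
    using lin[of x] by (simp flip: linear_add)
  then have "D x (z - y) - D y (z - y) =
      (F z - F y - D y (z - y)) - (F z - F x - D x (z - x)) + (F y - F x - D x (y - x))"
    by simp
  also have "norm \<dots> \<le> C * r\<^sup>2 + C * (4 * r\<^sup>2) + C * r\<^sup>2"
    by (rule norm_triangle_le[OF add_mono[OF norm_triangle_le_diff[OF add_mono[OF 2 1]] 3]])
  also have "\<dots> = 6 * C * r\<^sup>2" by (simp add: algebra_simps)
  finally have "norm (D x (z - y) - D y (z - y)) \<le> 6 * C * r\<^sup>2" .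
  moreover have "D x (z - y) - D y (z - y) = c *\<^sub>R (D x h - D y h)"
    using lin by (simp add: z_def linear_cmul scaleR_diff_right)
  ultimately have "c * norm (D x h - D y h) \<le> 6 * C * r\<^sup>2" using c by simp
  also have "\<dots> = c * (6 * C * r * norm h)"
    using False by (simp add: c_def power2_eq_square)
  finally have "norm (D x h - D y h) \<le> 6 * C * r * norm h"
    using c by (rule mult_left_le_imp_le)
  then show ?thesis by (simp add: r_def norm_minus_commute)
qed

lemma quadratic_remainder_imp_has_derivative:
  fixes F :: "'a::euclidean_space \<Rightarrow> 'b::real_normed_vector"
  assumes lin: "linear D" and C: "C \<ge> 0"
    and rem: "\<And>y. norm (F y - F x - D (y - x)) \<le> C * (norm (y - x))\<^sup>2"
  shows "(F has_derivative D) (at x within S)"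
proof (rule has_derivativeI)
  show "bounded_linear D" using lin by (simp add: linear_conv_bounded_linear)
  have "((\<lambda>y. C * norm (y - x)) \<longlongrightarrow> C * norm (x - x)) (at x within S)"
    by (intro tendsto_intros)
  then have 0: "((\<lambda>y. C * norm (y - x)) \<longlongrightarrow> 0) (at x within S)" by simp
  show "((\<lambda>y. (F y - F x - D (y - x)) /\<^sub>R norm (y - x)) \<longlongrightarrow> 0) (at x within S)"
  proof (rule Lim_null_comparison[OF _ 0])
    show "\<forall>\<^sub>F y in at x within S. norm ((F y - F x - D (y - x)) /\<^sub>R norm (y - x)) \<le> C * norm (y - x)"
      unfolding eventually_at_filter
    proof (intro always_eventually allI impI)
      fix y assume "y \<noteq> x"
      then show "norm ((F y - F x - D (y - x)) /\<^sub>R norm (y - x)) \<le> C * norm (y - x)"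
        using rem[of y] by (simp add: divide_simps power2_eq_square mult_ac)
    qed
  qed
qed

text \<open>The function \<open>u\<close> is the convex envelope of \<open>h = inf Q\<close>, written as the supremum of the affine
  minorants. It inherits the second difference bound of \<open>h\<close>, because averaging a minorant at
  \<open>z + v\<close> with one at \<open>z - v\<close> and subtracting \<open>C \<bar>v\<bar>\<^sup>2 / 2\<close> yields a minorant again.\<close>

lemma convex_envelope_quadratic_remainder:
  fixes Q :: "('a::euclidean_space \<Rightarrow> real) set"
  assumes ne: "Q \<noteq> {}"
    and cont: "\<And>q. q \<in> Q \<Longrightarrow> continuous_on UNIV q"
    and sc: "\<And>q x v. q \<in> Q \<Longrightarrow> q (x + v) + q (x - v) \<le> 2 * q x + C * (norm v)\<^sup>2"
    and aff: "\<forall>q\<in>Q. \<forall>z. c0 + g0 \<bullet> z \<le> q z"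
  obtains u g where
    "\<And>x y. \<bar>u y - u x - g x \<bullet> (y - x)\<bar> \<le> C * (norm (y - x))\<^sup>2"
    "\<And>q x. q \<in> Q \<Longrightarrow> u x \<le> q x"
    "\<And>c h x. (\<And>q z. q \<in> Q \<Longrightarrow> c + h \<bullet> z \<le> q z) \<Longrightarrow> c + h \<bullet> x \<le> u x"
proof -
  define M where "M = {(c, h). \<forall>q\<in>Q. \<forall>z. c + h \<bullet> z \<le> q z}"
  define val where "val m z = fst m + snd m \<bullet> z" for m :: "real \<times> 'a" and z :: 'a
  define u where "u x = (SUP m\<in>M. val m x)" for x
  obtain q0 where q0: "q0 \<in> Q" using ne by blast
  have Mne: "M \<noteq> {}" using aff by (auto simp: M_def)
  have Mle: "val m z \<le> q z" if "m \<in> M" "q \<in> Q" for m q z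
    using that by (auto simp: M_def val_def)
  have bdd: "bdd_above ((\<lambda>m. val m x) ` M)" for x
    using Mle[OF _ q0] by (intro bdd_aboveI2)
  have u_ge: "val m x \<le> u x" if "m \<in> M" for m x
    unfolding u_def using that bdd by (rule cSUP_upper)
  have u_le: "u x \<le> B" if "\<And>m. m \<in> M \<Longrightarrow> val m x \<le> B" for x B
    unfolding u_def using Mne that by (rule cSUP_least)
  \<comment> \<open>Almost optimal minorants at \<open>x\<close> have bounded slopes, so a
    subsequence of the slopes converges; the limit slope with value \<open>u x\<close> at
    \<open>x\<close> is again a minorant.\<close>
  have attained: "\<exists>m\<in>M. val m x = u x" for x
  proof -
    have "\<exists>m. m \<in> M \<and> val m x > u x - inverse (real (Suc n))" for n
      using less_cSUP_iff[OF Mne bdd, of "u x - inverse (real (Suc n))" x]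
      by (auto simp: u_def[symmetric])
    then obtain m where m: "\<And>n. m n \<in> M" "\<And>n. val (m n) x > u x - inverse (real (Suc n))"
      by metis
    obtain B where B: "\<And>y. y \<in> cball x 1 \<Longrightarrow> q0 y \<le> B"
    proof -
      have "compact (q0 ` cball x 1)"
        by (intro compact_continuous_image continuous_on_subset[OF cont[OF q0]]) auto
      then show ?thesis using that by (meson bdd_above.unfold bounded_imp_bdd_above compact_imp_bounded imageI)
    qed
    \<comment> \<open>Going one unit from \<open>x\<close> along the slope raises a minorant by the
      norm of the slope, from more than \<open>u x - 1\<close> to at most \<open>B\<close>.\<close>
    define B' where "B' = B - u x + 1"
    have slope: "norm (snd (m n)) \<le> B'" for n
    proof (cases "snd (m n) = 0")
      case True
      have "val (m n) x \<le> B" using Mle[OF m(1) q0, of n x] B[of x] by auto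
      moreover have "inverse (real (Suc n)) \<le> 1" by (simp add: field_simps)
      ultimately show ?thesis using m(2)[of n] True by (simp add: B'_def)
    next
      case False
      define w where "w = sgn (snd (m n))"
      have "val (m n) (x + w) \<le> B"
        using Mle[OF m(1) q0, of n "x + w"] B[of "x + w"]
        by (simp add: w_def dist_norm norm_sgn False)
      moreover have "val (m n) (x + w) = val (m n) x + norm (snd (m n))"
      proof -
        have "snd (m n) \<bullet> w = inverse (norm (snd (m n))) * (norm (snd (m n)))\<^sup>2"
          by (simp only: w_def sgn_div_norm inner_scaleR_right dot_square_norm)
        also have "\<dots> = norm (snd (m n))" using False by (simp add: power2_eq_square)
        finally show ?thesis by (simp add: val_def inner_add_right)
      qed
      moreover have "inverse (real (Suc n)) \<le> 1" by (simp add: field_simps)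
      ultimately show ?thesis using m(2)[of n] by (simp add: B'_def)
    qed
    have "snd (m n) \<in> cball 0 B'" for n using slope by simp
    then obtain h s where hs: "strict_mono s" "(\<lambda>n. snd (m (s n))) \<longlonglongrightarrow> h"
      using compact_cball[of 0 B', unfolded compact_def, rule_format, of "\<lambda>n. snd (m n)"]
      by (auto simp: o_def)
    have vlim: "(\<lambda>n. val (m (s n)) x) \<longlonglongrightarrow> u x"
    proof (rule tendsto_sandwich)
      have "(\<lambda>n. inverse (real (Suc (s n)))) \<longlonglongrightarrow> 0"
        using LIMSEQ_subseq_LIMSEQ[OF LIMSEQ_inverse_real_of_nat hs(1)] by (simp add: o_def)
      then have "(\<lambda>n. u x - inverse (real (Suc (s n)))) \<longlonglongrightarrow> u x - 0"
        by (intro tendsto_intros)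
      then show "(\<lambda>n. u x - inverse (real (Suc (s n)))) \<longlonglongrightarrow> u x" by simp
    qed (use m(2)[THEN less_imp_le] u_ge[OF m(1)] in \<open>auto simp del: of_nat_Suc\<close>)
    define c where "c = u x - h \<bullet> x"
    have "c + h \<bullet> z \<le> q z" if "q \<in> Q" for q z
    proof -
      have "(\<lambda>n. val (m (s n)) x + snd (m (s n)) \<bullet> (z - x)) \<longlonglongrightarrow> u x + h \<bullet> (z - x)"
        by (intro tendsto_intros vlim hs)
      moreover have "val (m (s n)) x + snd (m (s n)) \<bullet> (z - x) \<le> q z" for n
        using Mle[OF m(1) that, of "s n" z] by (simp add: val_def inner_diff_right)
      ultimately have "u x + h \<bullet> (z - x) \<le> q z"
        by (intro LIMSEQ_le_const2) auto
      then show ?thesis by (simp add: c_def inner_diff_right)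
    qed
    then have "(c, h) \<in> M" by (auto simp: M_def)
    moreover have "val (c, h) x = u x" by (simp add: val_def c_def)
    ultimately show ?thesis by blast
  qed
  then obtain m where m: "\<And>x. m x \<in> M" "\<And>x. val (m x) x = u x" by metis
  define g where "g x = snd (m x)" for x
  \<comment> \<open>The slope of a minorant touching \<open>u\<close> at \<open>x\<close> is a
    subgradient there.\<close>
  have sub: "u x + g x \<bullet> (y - x) \<le> u y" for x y
    using u_ge[OF m(1), of x y] m(2)[of x] by (simp add: g_def val_def inner_diff_right)
  have second: "u (x + v) + u (x - v) \<le> 2 * u x + C * (norm v)\<^sup>2" for x v
  proof -
    define m1 where "m1 = m (x + v)"
    define m2 where "m2 = m (x - v)"
    define c where "c = (fst m1 + snd m1 \<bullet> v + fst m2 - snd m2 \<bullet> v - C * (norm v)\<^sup>2) / 2"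
    define h where "h = (1 / 2) *\<^sub>R (snd m1 + snd m2)"
    have ch: "c + h \<bullet> z = (val m1 (z + v) + val m2 (z - v) - C * (norm v)\<^sup>2) / 2" for z
      by (simp add: c_def h_def val_def inner_add_left inner_add_right inner_diff_right field_simps)
    have "c + h \<bullet> z \<le> q z" if "q \<in> Q" for q z
      using Mle[OF m(1) that, of "x + v" "z + v"] Mle[OF m(1) that, of "x - v" "z - v"]
        sc[OF that, of z v] unfolding ch m1_def m2_def by simp
    then have "(c, h) \<in> M" by (auto simp: M_def)
    from u_ge[OF this, of x] have "c + h \<bullet> x \<le> u x" by (simp add: val_def)
    then show ?thesis unfolding ch by (simp add: m1_def m2_def m(2))
  qed
  show ?thesis
  proof
    fix x y
    show "\<bar>u y - u x - g x \<bullet> (y - x)\<bar> \<le> C * (norm (y - x))\<^sup>2"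
      \<comment> \<open>The subgradient inequality at \<open>y\<close> is the lower bound; at the
        reflection of \<open>y\<close> in \<open>x\<close>, combined with the second difference
        bound, it gives the upper one.\<close>
      using second[of x "y - x"] sub[of x y] sub[of x "x - (y - x)"]
      by (simp add: inner_diff_right)
  next
    fix q x assume "q \<in> Q" then show "u x \<le> q x" using Mle by (intro u_le)
  next
    fix c h x assume "\<And>q z. q \<in> Q \<Longrightarrow> c + h \<bullet> z \<le> q z"
    then have "(c, h) \<in> M" by (auto simp: M_def)
    from u_ge[OF this, of x] show "c + h \<bullet> x \<le> u x" by (simp add: val_def)
  qed
qed

text \<open>The paraboloids \<open>f x + G x \<bullet> (z - x) \<plusminus> K \<bar>z - x\<bar>\<^sup>2\<close> bound any extension; each lower one lies
  below each upper one. After adding \<open>K \<bar>z\<bar>\<^sup>2\<close> the lower ones are affine, so the convex envelope of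
  the upper ones is squeezed to the right value on \<open>E\<close>.\<close>

lemma C11_jet_extension_real:
  fixes f :: "'a::euclidean_space \<Rightarrow> real" and G :: "'a \<Rightarrow> 'a"
  assumes M: "M \<ge> 0"
    and rem: "\<And>x y. x \<in> E \<Longrightarrow> y \<in> E \<Longrightarrow> \<bar>f y - f x - G x \<bullet> (y - x)\<bar> \<le> M * (norm (y - x))\<^sup>2"
    and lip: "\<And>x y. x \<in> E \<Longrightarrow> y \<in> E \<Longrightarrow> norm (G x - G y) \<le> M * norm (x - y)"
  obtains u g where "\<And>x y. \<bar>u y - u x - g x \<bullet> (y - x)\<bar> \<le> 20 * M * (norm (y - x))\<^sup>2"
    "\<And>x. x \<in> E \<Longrightarrow> u x = f x"
proof (cases "E = {}")
  case True
  then show ?thesis using that[of "\<lambda>_. 0" "\<lambda>_. 0"] M by auto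
next
  case False
  \<comment> \<open>The factor \<open>4\<close> comes from the inequality between squares of
    \<open>\<alpha>\<close> and \<open>\<beta>\<close> proved below by completing the
    square.\<close>
  define K where "K = 4 * M"
  have K: "K \<ge> 0" using M by (simp add: K_def)
  define q where "q y z = f y + G y \<bullet> (z - y) + K * (norm (z - y))\<^sup>2 + K * (norm z)\<^sup>2" for y z
  have below: "f x + G x \<bullet> (z - x) - K * (norm (z - x))\<^sup>2 + K * (norm z)\<^sup>2 \<le> q y z"
    if xy: "x \<in> E" "y \<in> E" for x y z
  proof -
    define \<alpha> where "\<alpha> = norm (z - x)"
    define \<beta> where "\<beta> = norm (z - y)"
    have xy_le: "norm (x - y) \<le> \<alpha> + \<beta>"
      unfolding \<alpha>_def \<beta>_def using norm_triangle_ineq4[of "z - y" "z - x"] by simp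
    have "f x + G x \<bullet> (z - x) - (f y + G y \<bullet> (z - y)) = (f x - f y - G y \<bullet> (x - y)) + (G x - G y) \<bullet> (z - x)"
      by (simp add: inner_diff_left inner_diff_right)
    also have "\<dots> \<le> M * (norm (x - y))\<^sup>2 + norm (G x - G y) * \<alpha>"
      using rem[OF xy(2,1)] norm_cauchy_schwarz[of "G x - G y" "z - x"] unfolding \<alpha>_def by linarith
    also have "\<dots> \<le> M * (norm (x - y))\<^sup>2 + (M * norm (x - y)) * \<alpha>"
      using lip[OF xy] by (intro add_left_mono mult_right_mono) (auto simp: \<alpha>_def)
    also have "\<dots> = M * ((norm (x - y))\<^sup>2 + norm (x - y) * \<alpha>)" by (simp add: algebra_simps)
    also have "\<dots> \<le> M * ((\<alpha> + \<beta>)\<^sup>2 + (\<alpha> + \<beta>) * \<alpha>)"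
      using xy_le M by (intro mult_left_mono add_mono power_mono mult_right_mono) (auto simp: \<alpha>_def)
    also have "\<dots> \<le> M * (4 * (\<alpha>\<^sup>2 + \<beta>\<^sup>2))"
    proof (rule mult_left_mono[OF _ M])
      have "0 \<le> 2 * (\<alpha> - 3 / 4 * \<beta>)\<^sup>2 + 15 / 8 * \<beta>\<^sup>2" by simp
      then show "(\<alpha> + \<beta>)\<^sup>2 + (\<alpha> + \<beta>) * \<alpha> \<le> 4 * (\<alpha>\<^sup>2 + \<beta>\<^sup>2)"
        by (simp add: power2_eq_square algebra_simps)
    qed
    finally show ?thesis by (simp add: q_def K_def \<alpha>_def \<beta>_def algebra_simps)
  qed
  have affine_form: "f x + G x \<bullet> (z - x) - K * (norm (z - x))\<^sup>2 + K * (norm z)\<^sup>2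
      = (f x - G x \<bullet> x - K * (norm x)\<^sup>2) + (G x + (2 * K) *\<^sub>R x) \<bullet> z" for x z
    unfolding dot_square_norm[symmetric]
    by (simp add: inner_diff inner_add inner_commute algebra_simps)
  obtain x0 where "x0 \<in> E" using False by blast
  obtain U g where U: "\<And>x y. \<bar>U y - U x - g x \<bullet> (y - x)\<bar> \<le> (4 * K) * (norm (y - x))\<^sup>2"
    "\<And>p x. p \<in> q ` E \<Longrightarrow> U x \<le> p x"
    "\<And>c h x. (\<And>p z. p \<in> q ` E \<Longrightarrow> c + h \<bullet> z \<le> p z) \<Longrightarrow> c + h \<bullet> x \<le> U x"
  proof (rule convex_envelope_quadratic_remainder[of "q ` E" "4 * K"])
    show "q ` E \<noteq> {}" using False by simp
    show "continuous_on UNIV p" if "p \<in> q ` E" for p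
      using that by (auto simp: q_def[abs_def] intro!: continuous_intros)
    show "p (x + v) + p (x - v) \<le> 2 * p x + 4 * K * (norm v)\<^sup>2" if "p \<in> q ` E" for p x v
      using that unfolding q_def dot_square_norm[symmetric]
      by (auto simp: inner_diff inner_add inner_commute algebra_simps)
    show "\<forall>p\<in>q ` E. \<forall>z. (f x0 - G x0 \<bullet> x0 - K * (norm x0)\<^sup>2) + (G x0 + (2 * K) *\<^sub>R x0) \<bullet> z \<le> p z"
      using below[OF \<open>x0 \<in> E\<close>] unfolding affine_form by blast
  qed blast
  have UE: "U x = f x + K * (norm x)\<^sup>2" if "x \<in> E" for x
  proof (rule antisym)
    show "U x \<le> f x + K * (norm x)\<^sup>2" using U(2)[of "q x" x] that by (simp add: q_def)
    have "(f x - G x \<bullet> x - K * (norm x)\<^sup>2) + (G x + (2 * K) *\<^sub>R x) \<bullet> x \<le> U x"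
      using below[OF that] unfolding affine_form by (intro U(3)) auto
    then show "f x + K * (norm x)\<^sup>2 \<le> U x" unfolding affine_form[symmetric] by simp
  qed
  show ?thesis
  \<comment> \<open>Removing the added \<open>K\<close> times squared norm turns the constant
    \<open>4 * K\<close> into at most \<open>5 * K = 20 * M\<close>.\<close>
  proof (rule that[of "\<lambda>x. U x - K * (norm x)\<^sup>2" "\<lambda>x. g x - (2 * K) *\<^sub>R x"])
    fix x y
    have "U y - K * (norm y)\<^sup>2 - (U x - K * (norm x)\<^sup>2) - (g x - (2 * K) *\<^sub>R x) \<bullet> (y - x)
       = (U y - U x - g x \<bullet> (y - x)) - K * (norm (y - x))\<^sup>2"
      unfolding dot_square_norm[symmetric]
      by (simp add: inner_diff inner_add inner_commute algebra_simps)
    moreover have "0 \<le> K * (norm (y - x))\<^sup>2" using K by simp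
    ultimately show "\<bar>U y - K * (norm y)\<^sup>2 - (U x - K * (norm x)\<^sup>2) - (g x - (2 * K) *\<^sub>R x) \<bullet> (y - x)\<bar>
        \<le> 20 * M * (norm (y - x))\<^sup>2"
      using U(1)[of y x] by (simp add: K_def)
  qed (simp add: UE)
qed

text \<open>The scalar extension is applied to each coordinate, with the adjoint of
  \<open>\<Psi> x\<close> supplying the gradient; summing over the coordinates costs a factor
  \<open>DIM('b)\<close>.\<close>

lemma C11_jet_extension:
  fixes f :: "'a::euclidean_space \<Rightarrow> 'b::euclidean_space" and \<Psi> :: "'a \<Rightarrow> 'a \<Rightarrow> 'b"
  assumes M: "M \<ge> 0" and lin: "\<And>x. x \<in> E \<Longrightarrow> linear (\<Psi> x)"
    and rem: "\<And>x y. x \<in> E \<Longrightarrow> y \<in> E \<Longrightarrow> norm (f y - f x - \<Psi> x (y - x)) \<le> M * (norm (y - x))\<^sup>2"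
    and lip: "\<And>x y h. x \<in> E \<Longrightarrow> y \<in> E \<Longrightarrow> norm (\<Psi> x h - \<Psi> y h) \<le> M * norm (x - y) * norm h"
  obtains F D C where "C \<ge> 0" "\<And>x. linear (D x)"
    "\<And>x y. norm (F y - F x - D x (y - x)) \<le> C * (norm (y - x))\<^sup>2"
    "\<And>x. x \<in> E \<Longrightarrow> F x = f x"
proof -
  have "\<exists>u g. (\<forall>x y. \<bar>u y - u x - g x \<bullet> (y - x)\<bar> \<le> 20 * M * (norm (y - x))\<^sup>2) \<and>
      (\<forall>x\<in>E. u x = f x \<bullet> e)" if e: "e \<in> Basis" for e
  proof -
    define G where "G x = adjoint (\<Psi> x) e" for x
    have G: "G x \<bullet> h = \<Psi> x h \<bullet> e" if "x \<in> E" for x h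
      using adjoint_works[OF lin[OF that]] by (simp add: G_def inner_commute)
    have "\<bar>f y \<bullet> e - f x \<bullet> e - G x \<bullet> (y - x)\<bar> \<le> M * (norm (y - x))\<^sup>2" if "x \<in> E" "y \<in> E" for x y
      using rem[OF that] Basis_le_norm[OF e, of "f y - f x - \<Psi> x (y - x)"] G[OF that(1)]
      by (simp add: inner_diff_left)
    moreover have "norm (G x - G y) \<le> M * norm (x - y)" if "x \<in> E" "y \<in> E" for x y
    proof -
      define h where "h = G x - G y"
      have "norm h * norm h = (\<Psi> x h - \<Psi> y h) \<bullet> e"
        using G that by (simp add: h_def inner_diff_left flip: power2_eq_square dot_square_norm)
      also have "\<dots> \<le> norm (\<Psi> x h - \<Psi> y h)"
        using Basis_le_norm[OF e] by (meson abs_ge_self order_trans)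
      also have "\<dots> \<le> M * norm (x - y) * norm h" using lip that by blast
      finally have "norm h * norm h \<le> M * norm (x - y) * norm h" .
      then have "norm h \<le> M * norm (x - y)" using M by (cases "h = 0") auto
      then show ?thesis by (simp add: h_def)
    qed
    ultimately show ?thesis
      using C11_jet_extension_real[of M E "\<lambda>x. f x \<bullet> e" G] M by metis
  qed
  then obtain u g where
    u: "\<And>e x y. e \<in> Basis \<Longrightarrow> \<bar>u e y - u e x - g e x \<bullet> (y - x)\<bar> \<le> 20 * M * (norm (y - x))\<^sup>2"
    and uf: "\<And>e x. e \<in> Basis \<Longrightarrow> x \<in> E \<Longrightarrow> u e x = f x \<bullet> e"
    by metis
  define F where "F x = (\<Sum>e\<in>Basis. u e x *\<^sub>R e)" for x :: 'a
  define D where "D x h = (\<Sum>e\<in>Basis. (g e x \<bullet> h) *\<^sub>R e)" for x h :: 'a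
  show ?thesis
  proof
    show "0 \<le> DIM('b) * (20 * M)" using M by simp
    show "linear (D x)" for x
      unfolding D_def
      by (intro linearI) (simp_all add: inner_add_right scaleR_add_left sum.distrib scaleR_sum_right)
    show "norm (F y - F x - D x (y - x)) \<le> DIM('b) * (20 * M) * (norm (y - x))\<^sup>2" for x y
    proof -
      have "F y - F x - D x (y - x) = (\<Sum>e\<in>Basis. (u e y - u e x - g e x \<bullet> (y - x)) *\<^sub>R e)"
        by (simp add: F_def D_def sum_subtractf scaleR_diff_left)
      also have "norm \<dots> \<le> (\<Sum>e\<in>(Basis :: 'b set). 20 * M * (norm (y - x))\<^sup>2)"
        using u by (intro sum_norm_le) simp
      finally show ?thesis by simp
    qed
    show "F x = f x" if "x \<in> E" for x
      using uf that by (simp add: F_def euclidean_representation)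
  qed
qed

subsection \<open>The covering surface\<close>

theorem theorem4p1:
  fixes A :: "'a::euclidean_space set" and a :: 'a and k :: nat
  assumes "DIM('a) \<ge> 2" and "1 \<le> k" and "k \<le> DIM('a) - 1"
    and "positive_reach A" and "a \<in> T_k A k"
  shows "\<exists>\<delta>>0. \<exists>\<Gamma>. C11_surface k \<Gamma> \<and> T_k A k \<inter> ball a \<delta> \<subseteq> \<Gamma>"
proof -
  obtain \<epsilon> where \<epsilon>: "\<epsilon> > 0" and un: "unique_nearest A \<epsilon>"
    using assms(4) by (auto simp: positive_reach_def unique_nearest_def nearest_point_def)
  define R where "R = \<epsilon> / 2"
  have R: "0 < R" "R < \<epsilon>" using \<epsilon> by (auto simp: R_def)
  define W where "W = span (Tan A a)"
  have dimW: "dim W = k" using assms(5) by (auto simp: T_k_def W_def)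
  obtain \<pi> where \<pi>: "orthogonal_projection W \<pi>"
    using orthogonal_projection_exists[of W] by (auto simp: W_def)
  have lin\<pi>: "linear \<pi>" and W: "subspace W" "\<And>x. \<pi> x \<in> W" and orth: "\<And>w x. w \<in> W \<Longrightarrow> w \<bullet> (x - \<pi> x) = 0"
    using \<pi> by (auto simp: orthogonal_projection_def)
  obtain B where B: "B \<subseteq> Tan A a" "independent B" "Tan A a \<subseteq> span B" "card B = k"
    using basis_exists[of "Tan A a"] dimW by (metis W_def dim_span)
  have fin: "finite B" using B(2) by (rule independent_imp_finite)
  have BW: "b \<in> W" if "b \<in> B" for b using B(1) that by (auto simp: W_def span_base)
  obtain \<kappa> where \<kappa>: "\<kappa> > 0" "\<And>c. \<kappa> * (\<Sum>b\<in>B. \<bar>c b\<bar>) \<le> norm (\<Sum>b\<in>B. c b *\<^sub>R b)"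
    using independent_lower_bound[OF B(2)] by blast
  \<comment> \<open>Tangent vectors will approximate \<open>B\<close> up to
    \<open>2 * \<eta> = \<kappa> / 4\<close>, within the allowance of
    \<open>perturbed_basis\<close>, and the resulting tilt is exactly \<open>1 / 2\<close>.\<close>
  define \<eta> where "\<eta> = \<kappa> / 8"
  have \<eta>: "\<eta> > 0" using \<kappa> by (simp add: \<eta>_def)
  obtain \<delta>1 where \<delta>1: "\<delta>1 > 0"
    "\<And>u x t. u \<in> B \<Longrightarrow> x \<in> A \<Longrightarrow> dist x a < \<delta>1 \<Longrightarrow> 0 < t \<Longrightarrow> t \<le> \<delta>1 \<Longrightarrow>
      \<exists>p\<in>A. norm (p - x - t *\<^sub>R u) \<le> \<eta> * t"
    using Tan_uniform_finite[OF un R fin B(1) \<eta>] by blast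
  define m where "m = (\<Sum>b\<in>B. norm b) + \<eta> + 2"
  have bm: "norm b + \<eta> + 2 \<le> m" if "b \<in> B" for b
    unfolding m_def using fin that member_le_sum[of b B norm] by simp
  have m2: "m \<ge> 2" using \<eta> by (simp add: m_def sum_nonneg add_nonneg_nonneg)
  \<comment> \<open>Distances between points of \<open>S\<close> are then admissible scales for
    \<open>\<delta>1\<close>, and \<open>m\<close> times such a distance stays below
    \<open>R\<close>.\<close>
  define \<delta> where "\<delta> = min (\<delta>1 / 2) (R / (8 * m))"
  have \<delta>: "\<delta> > 0" "2 * \<delta> \<le> \<delta>1" "4 * \<delta> * m < R"
    using \<delta>1 R m2 by (auto simp: \<delta>_def min_def field_simps)
  define S where "S = T_k A k \<inter> ball a \<delta>"
  have SA: "x \<in> A" and Sa: "dist x a < \<delta>" and SL: "dim (span (Tan A x)) = k" if "x \<in> S" for x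
    using that by (auto simp: S_def T_k_def dist_commute)
  have SS: "dist x y < 2 * \<delta>" if "x \<in> S" "y \<in> S" for x y
    using Sa[OF that(1)] Sa[OF that(2)] dist_triangle2[of x y a] by simp
  \<comment> \<open>The dimension condition enters here: tangent vectors at \<open>x\<close> close
    to the basis \<open>B\<close> of \<open>W\<close> already form a basis of the span. As
    \<open>\<pi>\<close> fixes \<open>B\<close>, only the errors \<open>f b - b\<close> have normal
    components.\<close>
  have tilt: "norm (v - \<pi> v) \<le> norm v / 2" if x: "x \<in> S" and v: "v \<in> span (Tan A x)" for x v
  proof -
    have "\<exists>w\<in>Tan A x. norm (w - b) \<le> 2 * \<eta>" if "b \<in> B" for b
    proof -
      have "dist x a < \<delta>1" using Sa[OF x] \<delta> \<delta>1(1) by simp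
      then show ?thesis
        using Tan_near_of_approximation[OF un R SA[OF x] \<eta> \<delta>1(1)] \<delta>1(2)[OF that SA[OF x]] by metis
    qed
    then obtain f where f: "\<And>b. b \<in> B \<Longrightarrow> f b \<in> Tan A x" "\<And>b. b \<in> B \<Longrightarrow> norm (f b - b) \<le> 2 * \<eta>"
      by metis
    obtain c where c: "v = (\<Sum>b\<in>B. c b *\<^sub>R f b)" "(\<Sum>b\<in>B. \<bar>c b\<bar>) \<le> 2 / \<kappa> * norm v"
    proof (rule perturbed_basis[OF B(2) \<kappa> subspace_span _ _ _ v])
      show "dim (span (Tan A x)) = card B" using SL[OF x] B(4) by simp
      show "f b \<in> span (Tan A x)" if "b \<in> B" for b using f(1)[OF that] by (rule span_base)
      show "norm (f b - b) \<le> \<kappa> / 2" if "b \<in> B" for b using f(2)[OF that] \<kappa>(1) by (simp add: \<eta>_def)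
    qed blast
    have "v - \<pi> v = (\<Sum>b\<in>B. c b *\<^sub>R ((f b - b) - \<pi> (f b - b)))"
    proof -
      have "c b *\<^sub>R ((f b - b) - \<pi> (f b - b)) = c b *\<^sub>R f b - \<pi> (c b *\<^sub>R f b)" if "b \<in> B" for b
        using orthogonal_projection_id[OF \<pi> BW[OF that]] lin\<pi>
        by (simp add: linear_diff linear_cmul scaleR_diff_right)
      then show ?thesis using lin\<pi> by (simp add: c(1) linear_sum sum_subtractf)
    qed
    also have "norm \<dots> \<le> (\<Sum>b\<in>B. \<bar>c b\<bar> * (2 * \<eta>))"
    proof (rule sum_norm_le)
      fix b assume b: "b \<in> B"
      have "norm ((f b - b) - \<pi> (f b - b)) \<le> 2 * \<eta>"
        using orthogonal_projection_norm(2)[OF \<pi>, of "f b - b"] f(2)[OF b] by linarith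
      then show "norm (c b *\<^sub>R ((f b - b) - \<pi> (f b - b))) \<le> \<bar>c b\<bar> * (2 * \<eta>)"
        unfolding norm_scaleR by (intro mult_left_mono) auto
    qed
    also have "\<dots> = (\<Sum>b\<in>B. \<bar>c b\<bar>) * (2 * \<eta>)" by (rule sum_distrib_right[symmetric])
    also have "\<dots> \<le> 2 / \<kappa> * norm v * (2 * \<eta>)" using c(2) \<eta> by (intro mult_right_mono) auto
    also have "\<dots> = norm v / 2" using \<kappa>(1) by (simp add: \<eta>_def)
    finally show ?thesis .
  qed
  have "\<exists>\<Psi>. linear \<Psi> \<and> (\<forall>v\<in>span (Tan A x). \<Psi> v = v - \<pi> v) \<and> (\<forall>h. norm (\<Psi> h) \<le> norm (\<pi> h))
      \<and> (\<forall>h. \<Psi> (\<pi> h) = \<Psi> h)" if "x \<in> S" for x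
    using graph_over_subspace[OF \<pi> subspace_span _ tilt[OF that]] SL[OF that] dimW by metis
  then obtain \<Psi> where lin\<Psi>: "\<And>x. x \<in> S \<Longrightarrow> linear (\<Psi> x)"
    and \<Psi>L: "\<And>x v. x \<in> S \<Longrightarrow> v \<in> span (Tan A x) \<Longrightarrow> \<Psi> x v = v - \<pi> v"
    and \<Psi>n: "\<And>x h. x \<in> S \<Longrightarrow> norm (\<Psi> x h) \<le> norm (\<pi> h)"
    and \<Psi>\<pi>: "\<And>x h. x \<in> S \<Longrightarrow> \<Psi> x (\<pi> h) = \<Psi> x h"
    by metis
  \<comment> \<open>The normal component of \<open>h\<close> minus the one predicted by the tangent
    space at \<open>x\<close>; it vanishes on that space and at most doubles norms.\<close>
  define N where "N x h = h - \<pi> h - \<Psi> x h" for x h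
  have N_diff: "N x (h - h') = N x h - N x h'" if "x \<in> S" for x h h'
    using linear_diff[OF lin\<pi>] linear_diff[OF lin\<Psi>[OF that]] by (simp add: N_def)
  have N_small: "norm (N x (y - x)) \<le> 2 / R * r\<^sup>2"
    if x: "x \<in> S" and y: "y \<in> A" and r: "norm (y - x) \<le> r" "r < R" for x y r
  proof -
    obtain v where v: "v \<in> Tan A x" "norm (v - (y - x)) \<le> (norm (y - x))\<^sup>2 / R"
      using Tan_near_difference[OF un R SA[OF x] y] r by (auto simp: dist_norm norm_minus_commute)
    define e where "e = v - (y - x)"
    have "N x v = 0" using \<Psi>L[OF x] v(1) by (simp add: N_def span_base)
    then have "norm (N x (y - x)) = norm (N x e)"
      using N_diff[OF x, of v "y - x"] by (simp add: e_def)
    also have "\<dots> \<le> norm (e - \<pi> e) + norm (\<Psi> x e)" unfolding N_def by (rule norm_triangle_ineq4)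
    also have "\<dots> \<le> 2 * norm e"
      using orthogonal_projection_norm[OF \<pi>, of e] \<Psi>n[OF x, of e] by linarith
    also have "norm e \<le> r\<^sup>2 / R"
      using v(2) r R power_mono[OF r(1), of 2] unfolding e_def
      by (meson divide_right_mono less_imp_le norm_ge_zero order_trans)
    finally show ?thesis by simp
  qed
  \<comment> \<open>Splitting \<open>y - x\<close> into its \<open>\<pi>\<close>,
    \<open>\<Psi> x\<close> and \<open>N x\<close> parts, the last is at most half of the norm and
    is absorbed. So \<open>\<pi>\<close> has a Lipschitz inverse on its image of
    \<open>S\<close>.\<close>
  have bilip: "norm (y - x) \<le> 4 * norm (\<pi> y - \<pi> x)" if x: "x \<in> S" and y: "y \<in> S" for x y
  proof -
    define t where "t = norm (y - x)"
    have "t < 2 * \<delta>" using SS[OF y x] by (simp add: t_def dist_norm)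
    moreover have "4 * \<delta> * 2 \<le> 4 * \<delta> * m" using \<delta>(1) m2 by (intro mult_left_mono) auto
    moreover have "0 \<le> t" by (simp add: t_def)
    ultimately have tR: "4 * t \<le> R" "t < R" using \<delta>(3) by linarith+
    have "t = norm (\<pi> (y - x) + (\<Psi> x (y - x) + N x (y - x)))" by (simp add: t_def N_def)
    also have "\<dots> \<le> norm (\<pi> (y - x)) + (norm (\<Psi> x (y - x)) + norm (N x (y - x)))"
      by (meson add_left_mono norm_triangle_ineq norm_triangle_mono order_refl order_trans)
    also have "\<dots> \<le> 2 * norm (\<pi> (y - x)) + 2 / R * t\<^sup>2"
      using \<Psi>n[OF x, of "y - x"] N_small[OF x SA[OF y], of t] tR by (simp add: t_def)
    finally have "t \<le> 2 * norm (\<pi> (y - x)) + 2 / R * t\<^sup>2" .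
    moreover have "2 / R * t\<^sup>2 \<le> t / 2"
    proof -
      have "t * (4 * t) \<le> t * R" using tR by (intro mult_left_mono) (auto simp: t_def)
      then show ?thesis using R by (simp add: field_simps power2_eq_square)
    qed
    ultimately show ?thesis by (simp add: t_def linear_diff[OF lin\<pi>])
  qed
  have \<Psi>lip: "norm (\<Psi> x h - \<Psi> y h) \<le> 12 * m\<^sup>2 / (R * \<kappa>) * norm (x - y) * norm h"
    if x: "x \<in> S" and y: "y \<in> S" for x y h
  proof (cases "x = y")
    case False
    define t where "t = norm (x - y)"
    have t: "t > 0" "t < 2 * \<delta>" using SS[OF x y] False by (auto simp: t_def dist_norm)
    have tm: "m * t < R"
    proof -
      have "m * t \<le> m * (2 * \<delta>)" using t m2 by (intro mult_left_mono) auto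
      then show ?thesis using \<delta>(3) R(1) by (simp add: mult.commute)
    qed
    have "dist y a < \<delta>1" "t \<le> \<delta>1" using Sa[OF y] t \<delta> \<delta>1(1) by auto
    then have "\<exists>p\<in>A. norm (p - y - t *\<^sub>R b) \<le> \<eta> * t" if "b \<in> B" for b
      using \<delta>1(2)[OF that SA[OF y]] t by blast
    then obtain p where p: "\<And>b. b \<in> B \<Longrightarrow> p b \<in> A" "\<And>b. b \<in> B \<Longrightarrow> norm (p b - y - t *\<^sub>R b) \<le> \<eta> * t"
      by metis
    \<comment> \<open>Projected secants from \<open>y\<close> to points of \<open>A\<close> near
      \<open>y + t b\<close>; they form a basis of \<open>W\<close> on which \<open>\<Psi> x\<close>
      and \<open>\<Psi> y\<close> can be compared.\<close>
    define f where "f b = \<pi> (inverse t *\<^sub>R (p b - y))" for b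
    obtain c where c: "\<pi> h = (\<Sum>b\<in>B. c b *\<^sub>R f b)" "(\<Sum>b\<in>B. \<bar>c b\<bar>) \<le> 2 / \<kappa> * norm (\<pi> h)"
    proof (rule perturbed_basis[OF B(2) \<kappa> W(1)])
      show "dim W = card B" using dimW B(4) by simp
      show "f b \<in> W" for b by (simp add: f_def W)
      show "\<pi> h \<in> W" by (rule W)
      show "norm (f b - b) \<le> \<kappa> / 2" if b: "b \<in> B" for b
      proof -
        have "f b - b = \<pi> (inverse t *\<^sub>R (p b - y) - b)"
          using lin\<pi> orthogonal_projection_id[OF \<pi> BW[OF b]] by (simp add: f_def linear_diff)
        also have "norm \<dots> \<le> norm (inverse t *\<^sub>R (p b - y) - b)" by (rule orthogonal_projection_norm[OF \<pi>])
        also have "inverse t *\<^sub>R (p b - y) - b = inverse t *\<^sub>R (p b - y - t *\<^sub>R b)"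
          using t by (simp add: scaleR_diff_right)
        also have "norm \<dots> \<le> inverse t * (\<eta> * t)"
          unfolding norm_scaleR using p(2)[OF b] t by (simp add: mult_left_mono)
        also have "\<dots> \<le> \<kappa> / 2" using t \<kappa> by (simp add: \<eta>_def)
        finally show ?thesis .
      qed
    qed blast
    have diff_f: "norm (\<Psi> x (f b) - \<Psi> y (f b)) \<le> 6 / R * m\<^sup>2 * t" if b: "b \<in> B" for b
    proof -
      have "norm (p b - y) \<le> norm (p b - y - t *\<^sub>R b) + norm (t *\<^sub>R b)"
        using norm_triangle_ineq[of "p b - y - t *\<^sub>R b" "t *\<^sub>R b"] by simp
      also have "\<dots> \<le> \<eta> * t + norm b * t" using p(2)[OF b] t by (simp add: mult.commute)
      finally have py0: "norm (p b - y) \<le> (norm b + \<eta>) * t" by (simp add: algebra_simps)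
      have "norm (p b - x) \<le> norm (p b - y) + t"
        using norm_triangle_ineq4[of "p b - y" "x - y"] by (simp add: t_def)
      then have "norm (p b - x) \<le> (norm b + \<eta> + 1) * t" using py0 by (simp add: algebra_simps)
      moreover have "(norm b + \<eta>) * t \<le> m * t" "(norm b + \<eta> + 1) * t \<le> m * t" "1 * t \<le> m * t"
        using bm[OF b] t m2 by (auto intro!: mult_right_mono)
      ultimately have le: "norm (p b - y) \<le> m * t" "norm (p b - x) \<le> m * t" "norm (y - x) \<le> m * t"
        using py0 by (auto simp: t_def norm_minus_commute)
      \<comment> \<open>All three differences join a point of \<open>S\<close> to a point of
        \<open>A\<close> at distance at most \<open>m * t\<close>, so each \<open>N\<close> term is
        quadratic in \<open>t\<close>.\<close>
      have "\<Psi> x (p b - y) - \<Psi> y (p b - y) = N y (p b - y) - N x ((p b - x) - (y - x))"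
        by (simp add: N_def)
      also have "\<dots> = N y (p b - y) - N x (p b - x) + N x (y - x)"
        unfolding N_diff[OF x, of "p b - x"] by simp
      also have "norm \<dots> \<le> 2 / R * (m * t)\<^sup>2 + 2 / R * (m * t)\<^sup>2 + 2 / R * (m * t)\<^sup>2"
        by (rule norm_triangle_le[OF add_mono[OF norm_triangle_le_diff[OF add_mono]]])
           (intro N_small x y p b le tm SA)+
      also have "\<dots> = t * (6 / R * m\<^sup>2 * t)" by (simp add: power2_eq_square)
      finally have "norm (\<Psi> x (p b - y) - \<Psi> y (p b - y)) \<le> t * (6 / R * m\<^sup>2 * t)" .
      moreover have "\<Psi> x (f b) - \<Psi> y (f b) = inverse t *\<^sub>R (\<Psi> x (p b - y) - \<Psi> y (p b - y))"
        unfolding f_def \<Psi>\<pi>[OF x] \<Psi>\<pi>[OF y] linear_cmul[OF lin\<Psi>[OF x]] linear_cmul[OF lin\<Psi>[OF y]]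
        by (simp add: scaleR_diff_right)
      ultimately have "norm (\<Psi> x (f b) - \<Psi> y (f b)) \<le> inverse t * (t * (6 / R * m\<^sup>2 * t))"
        using t mult_left_mono[of _ _ "inverse t"] by (metis abs_of_pos inverse_nonnegative_iff_nonnegative
            less_imp_le norm_scaleR positive_imp_inverse_positive)
      also have "\<dots> = 6 / R * m\<^sup>2 * t" using t by (simp add: field_simps)
      finally show ?thesis .
    qed
    have "\<Psi> x h - \<Psi> y h = \<Psi> x (\<pi> h) - \<Psi> y (\<pi> h)" using \<Psi>\<pi> x y by simp
    also have "\<dots> = (\<Sum>b\<in>B. c b *\<^sub>R (\<Psi> x (f b) - \<Psi> y (f b)))"
      unfolding c(1) linear_sum[OF lin\<Psi>[OF x]] linear_sum[OF lin\<Psi>[OF y]]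
        linear_cmul[OF lin\<Psi>[OF x]] linear_cmul[OF lin\<Psi>[OF y]]
      by (simp add: sum_subtractf scaleR_diff_right)
    also have "norm \<dots> \<le> (\<Sum>b\<in>B. \<bar>c b\<bar> * (6 / R * m\<^sup>2 * t))"
      by (rule sum_norm_le) (unfold norm_scaleR, intro mult_left_mono diff_f abs_ge_zero)
    also have "\<dots> = (\<Sum>b\<in>B. \<bar>c b\<bar>) * (6 / R * m\<^sup>2 * t)" by (rule sum_distrib_right[symmetric])
    also have "\<dots> \<le> 2 / \<kappa> * norm h * (6 / R * m\<^sup>2 * t)"
    proof (rule mult_right_mono)
      have "2 / \<kappa> * norm (\<pi> h) \<le> 2 / \<kappa> * norm h"
        using \<kappa>(1) orthogonal_projection_norm(1)[OF \<pi>] by (intro mult_left_mono) auto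
      then show "(\<Sum>b\<in>B. \<bar>c b\<bar>) \<le> 2 / \<kappa> * norm h" using c(2) by linarith
    qed (use t R in auto)
    also have "\<dots> = 12 * m\<^sup>2 / (R * \<kappa>) * norm (x - y) * norm h" by (simp add: t_def mult_ac)
    finally show ?thesis .
  qed simp

  define \<sigma> where "\<sigma> = inv_into S \<pi>"
  have inj: "inj_on \<pi> S" using bilip by (fastforce intro: inj_onI)
  have \<sigma>: "\<sigma> (\<pi> x) = x" if "x \<in> S" for x using inj that by (simp add: \<sigma>_def)
  \<comment> \<open>The constants of \<open>N_small\<close> and of the Lipschitz bound for
    \<open>\<Psi>\<close>, multiplied by \<open>16\<close> and by \<open>4\<close> when distances in
    \<open>S\<close> are replaced by distances of projections.\<close>
  define M where "M = max (32 / R) (48 * m\<^sup>2 / (R * \<kappa>))"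
  obtain F D C where C: "C \<ge> 0" and linD: "\<And>x. linear (D x)"
    and rem: "\<And>x y. norm (F y - F x - D x (y - x)) \<le> C * (norm (y - x))\<^sup>2"
    and F: "\<And>w. w \<in> \<pi> ` S \<Longrightarrow> F w = \<sigma> w - w"
  proof (rule C11_jet_extension[of M "\<pi> ` S" "\<lambda>w. \<Psi> (\<sigma> w)" "\<lambda>w. \<sigma> w - w"])
    show "M \<ge> 0" using R by (simp add: M_def le_max_iff_disj)
    show "linear (\<Psi> (\<sigma> w))" if "w \<in> \<pi> ` S" for w using lin\<Psi> \<sigma> that by auto
    show "norm (\<sigma> w' - w' - (\<sigma> w - w) - \<Psi> (\<sigma> w) (w' - w)) \<le> M * (norm (w' - w))\<^sup>2"
      if w: "w \<in> \<pi> ` S" "w' \<in> \<pi> ` S" for w w'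
    proof -
      obtain x y where x: "x \<in> S" "w = \<pi> x" and y: "y \<in> S" "w' = \<pi> y" using w by blast
      have "\<sigma> w' - w' - (\<sigma> w - w) - \<Psi> (\<sigma> w) (w' - w) = N x (y - x)"
        using x y \<sigma> \<Psi>\<pi>[OF x(1), of "y - x"] by (simp add: N_def linear_diff[OF lin\<pi>])
      also have "norm \<dots> \<le> 2 / R * (norm (y - x))\<^sup>2"
      proof (rule N_small[OF x(1) SA[OF y(1)] order_refl])
        have "norm (y - x) < 2 * \<delta>" using SS[OF y(1) x(1)] by (simp add: dist_norm)
        also have "\<dots> \<le> 2 * \<delta> * m" using \<delta>(1) m2 by simp
        finally show "norm (y - x) < R" using \<delta>(3) R(1) by simp
      qed
      also have "\<dots> \<le> 2 / R * (4 * norm (w' - w))\<^sup>2"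
        using bilip[OF x(1) y(1)] x y R by (intro mult_left_mono power_mono) auto
      also have "\<dots> = 32 / R * (norm (w' - w))\<^sup>2" by (simp add: power_mult_distrib)
      also have "\<dots> \<le> M * (norm (w' - w))\<^sup>2" by (intro mult_right_mono) (auto simp: M_def)
      finally show ?thesis .
    qed
    show "norm (\<Psi> (\<sigma> w) h - \<Psi> (\<sigma> w') h) \<le> M * norm (w - w') * norm h"
      if w: "w \<in> \<pi> ` S" "w' \<in> \<pi> ` S" for w w' h
    proof -
      obtain x y where x: "x \<in> S" "w = \<pi> x" and y: "y \<in> S" "w' = \<pi> y" using w by blast
      have "norm (\<Psi> (\<sigma> w) h - \<Psi> (\<sigma> w') h) \<le> 12 * m\<^sup>2 / (R * \<kappa>) * norm (x - y) * norm h"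
        using \<Psi>lip[OF x(1) y(1)] x y \<sigma> by simp
      also have "\<dots> \<le> 12 * m\<^sup>2 / (R * \<kappa>) * (4 * norm (w - w')) * norm h"
        using bilip[OF y(1) x(1)] x y R \<kappa>(1) by (intro mult_right_mono mult_left_mono) auto
      also have "\<dots> = 48 * m\<^sup>2 / (R * \<kappa>) * norm (w - w') * norm h" by simp
      also have "\<dots> \<le> M * norm (w - w') * norm h" by (intro mult_right_mono) (auto simp: M_def)
      finally show ?thesis .
    qed
  qed blast

  define \<phi> where "\<phi> w = F w - \<pi> (F w)" for w
  define D' where "D' w h = D w h - \<pi> (D w h)" for w h
  have linD': "linear (D' w)" for w
    unfolding D'_def using linD[of w] lin\<pi>
    by (intro linearI) (simp_all add: linear_add linear_cmul scaleR_diff_right)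
  have rem': "norm (\<phi> y - \<phi> x - D' x (y - x)) \<le> C * (norm (y - x))\<^sup>2" for x y
  proof -
    define q where "q = F y - F x - D x (y - x)"
    have "\<phi> y - \<phi> x - D' x (y - x) = q - \<pi> q"
      by (simp add: \<phi>_def D'_def q_def linear_diff[OF lin\<pi>])
    then show ?thesis
      using orthogonal_projection_norm(2)[OF \<pi>, of q] rem[of y x] by (simp add: q_def)
  qed
  define \<Gamma> where "\<Gamma> = {w + \<phi> w | w. w \<in> W}"
  have "C11_surface k \<Gamma>"
    unfolding C11_surface_def
  proof (intro exI conjI)
    show "\<forall>w\<in>W. \<forall>v\<in>W. v \<bullet> \<phi> w = 0" using orth by (simp add: \<phi>_def)
    show "\<forall>w\<in>W. (\<phi> has_derivative D' w) (at w within W)"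
      using quadratic_remainder_imp_has_derivative[OF linD' C] rem' by blast
    show "\<forall>w1\<in>W. \<forall>w2\<in>W. \<forall>h\<in>W. norm (D' w1 h - D' w2 h) \<le> (6 * C) * norm (w1 - w2) * norm h"
      using quadratic_remainder_imp_Lipschitz_derivative[of D' C \<phi>, OF linD' C rem'] by blast
  qed (use W dimW \<Gamma>_def in auto)
  moreover have "T_k A k \<inter> ball a \<delta> \<subseteq> \<Gamma>"
  proof
    fix x assume "x \<in> T_k A k \<inter> ball a \<delta>"
    then have x: "x \<in> S" by (simp add: S_def)
    have "\<phi> (\<pi> x) = x - \<pi> x"
      using F[of "\<pi> x"] x \<sigma>[OF x] orthogonal_projection_id[OF \<pi> W(2)] by (simp add: \<phi>_def linear_diff[OF lin\<pi>])
    then have "x = \<pi> x + \<phi> (\<pi> x)" by simp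
    then show "x \<in> \<Gamma>" using W(2) unfolding \<Gamma>_def by blast
  qed
  ultimately show ?thesis using \<delta>(1) by blast
qed

end
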